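(* Let $R$ be a Noetherian local ring (respectively a graded ring) of prime characteristic $p>0$ and let $x\in R$ be an $F$-depth element (respectively a homogeneous $F$-depth element) on $R$. Suppose $R/xR$ is weakly $F$-nilpotent. Then $R$ is weakly $F$-nilpotent.
   Context: "Graded ring" means a Noetherian $\mathbf N$-graded ring $R$ whose degree $0$ part is a local ring $(S,\mathfrak n)$ of characteristic $p$; then $\mathfrak m=\mathfrak n+R_+$. In the local case $\mathfrak m$ is the maximal ideal. For $M=R$ or $M=R/xR$, the Frobenius map (viewed as an $R$-linear map $M\to F_*M$, $F_*$ being restriction of scalars along Frobenius) induces on each $H^j_{\mathfrak m}(M)$ a Frobenius action $\rho$, i.e. an additive map with $\rho(r\xi)=r^p\rho(\xi)$. $H^j_{\mathfrak m}(M)$ is nilpotent if each of its elements is killed by some iterate $\rho^e$. Set $\operatorname{Fdepth}(M)=\inf\{j\in\mathbf N\mid H^j_{\mathfrak m}(M)\text{ is not nilpotent}\}$. An element $x\in R$ which is regular on $R$ is an $F$-depth element on $R$ if $\operatorname{Fdepth}(R/xR)=\operatorname{Fdepth}(R)-1$. A ring $A$ (either a Noetherian local ring of prime characteristic $p>0$ with maximal ideal $\mathfrak m$, or a Noetherian $\mathbf N$-graded ring whose degree $0$ part is a local ring $(A_0,\mathfrak n_0)$ of prime characteristic $p>0$, with homogeneous maximal ideal $\mathfrak m=\mathfrak n_0+A_+$, where $A_+$ is the ideal generated by the homogeneous elements of positive degree) is weakly $F$-nilpotent if $H^j_{\mathfrak m}(A)$ is nilpotent for all $j<\dim A$, equivalently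 $\operatorname{Fdepth}(A)=\dim A$. *)

theory Defs
  imports "HOL-Algebra.Algebra" "HOL-Library.Extended_Nat"
begin

section \<open>Local and graded rings of prime characteristic\<close>

text \<open>For \<open>p\<close> prime, \<open>p \<cdot> 1 = 0\<close> and \<open>1 \<noteq> 0\<close> say that the characteristic is exactly \<open>p\<close>.\<close>

definition has_prime_char :: "('a, 'm) ring_scheme \<Rightarrow> nat \<Rightarrow> bool" where
  "has_prime_char A p \<longleftrightarrow>
     Factorial_Ring.prime p \<and> \<one>\<^bsub>A\<^esub> \<noteq> \<zero>\<^bsub>A\<^esub> \<and> add_pow A p \<one>\<^bsub>A\<^esub> = \<zero>\<^bsub>A\<^esub>"

definition local_ring :: "('a, 'm) ring_scheme \<Rightarrow> bool" where
  "local_ring A \<longleftrightarrow> cring A \<and> (\<exists>!I. maximalideal I A)"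

definition the_max_ideal :: "('a, 'm) ring_scheme \<Rightarrow> 'a set" where
  "the_max_ideal A = (THE I. maximalideal I A)"

definition noetherian_local_ring :: "('a, 'm) ring_scheme \<Rightarrow> nat \<Rightarrow> bool" where
  "noetherian_local_ring A p \<longleftrightarrow> noetherian_ring A \<and> local_ring A \<and> has_prime_char A p"

text \<open>An \<open>\<nat>\<close>-grading of a ring is given internally, by the family \<open>G\<close> of its homogeneous components.\<close>

definition nat_graded :: "('a, 'm) ring_scheme \<Rightarrow> (nat \<Rightarrow> 'a set) \<Rightarrow> bool" where
  "nat_graded A G \<longleftrightarrow>
     cring A \<and>
     (\<forall>n. subgroup (G n) (add_monoid A)) \<and>
     \<one>\<^bsub>A\<^esub> \<in> G 0 \<and>
     (\<forall>i j. \<forall>a\<in>G i. \<forall>b\<in>G j. a \<otimes>\<^bsub>A\<^esub> b \<in> G (i + j)) \<and>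
     (\<forall>a\<in>carrier A. \<exists>!c :: nat \<Rightarrow> 'a.
        (\<forall>n. c n \<in> G n) \<and> finite {n. c n \<noteq> \<zero>\<^bsub>A\<^esub>} \<and>
        a = (\<Oplus>\<^bsub>A\<^esub>n\<in>{n. c n \<noteq> \<zero>\<^bsub>A\<^esub>}. c n))"

definition graded_ring :: "('a, 'm) ring_scheme \<Rightarrow> (nat \<Rightarrow> 'a set) \<Rightarrow> nat \<Rightarrow> bool" where
  "graded_ring A G p \<longleftrightarrow>
     noetherian_ring A \<and> nat_graded A G \<and>
     local_ring (A\<lparr>carrier := G 0\<rparr>) \<and> has_prime_char (A\<lparr>carrier := G 0\<rparr>) p"

definition homog_max_ideal :: "('a, 'm) ring_scheme \<Rightarrow> (nat \<Rightarrow> 'a set) \<Rightarrow> 'a set" where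
  "homog_max_ideal A G =
     the_max_ideal (A\<lparr>carrier := G 0\<rparr>) <+>\<^bsub>A\<^esub> Idl\<^bsub>A\<^esub> (\<Union>n\<in>{0<..}. G n)"

definition quot_grading ::
    "('a, 'm) ring_scheme \<Rightarrow> 'a set \<Rightarrow> (nat \<Rightarrow> 'a set) \<Rightarrow> nat \<Rightarrow> 'a set set" where
  "quot_grading A I G n = (\<lambda>a. I +>\<^bsub>A\<^esub> a) ` G n"

definition krull_dim :: "('a, 'm) ring_scheme \<Rightarrow> enat" where
  "krull_dim A =
     Sup {enat n | n. \<exists>P :: nat \<Rightarrow> 'a set. (\<forall>i\<le>n. primeideal (P i) A) \<and> (\<forall>i<n. P i \<subset> P (Suc i))}"


section \<open>Local cohomology with its Frobenius action\<close>

text \<open>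
  Throughout, \<open>M\<close> is an \<open>R\<close>-algebra, regarded as an \<open>R\<close>-module together with its Frobenius map
  \<open>y \<mapsto> y\<^sup>p\<close>. The cases of interest are \<open>M = R\<close> and \<open>M = R/xR\<close>; both are obtained by turning a ring \<open>A\<close>
  into an algebra along a ring homomorphism \<open>h\<close>.
\<close>

definition algebra_via :: "('a \<Rightarrow> 'b) \<Rightarrow> ('b, 'n) ring_scheme \<Rightarrow> ('a, 'b) module" where
  "algebra_via h A =
     \<lparr>carrier = carrier A, monoid.mult = monoid.mult A, one = \<one>\<^bsub>A\<^esub>, ring.zero = \<zero>\<^bsub>A\<^esub>, ring.add = ring.add A,
      smult = (\<lambda>r y. h r \<otimes>\<^bsub>A\<^esub> y)\<rparr>"

text \<open>
  The localization \<open>M\<^sub>f\<close>: the fraction \<open>m/f\<^sup>k\<close> is the class of the pair \<open>(m, k)\<close>. Only the additive group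
  of \<open>M\<^sub>f\<close> is recorded. As with all groups of HOL-Algebra it is written multiplicatively, so that
  \<open>\<otimes>\<close>, \<open>\<one>\<close>, \<open>inv\<close>, \<open>\<Otimes>\<close> below denote addition, zero, negation and sums of fractions.
\<close>

definition frac_rel ::
    "('a, 'm) ring_scheme \<Rightarrow> ('a, 'b, 'n) module_scheme \<Rightarrow> 'a \<Rightarrow> (('b \<times> nat) \<times> ('b \<times> nat)) set" where
  "frac_rel R M f =
     {((m, k), (m', k')). m \<in> carrier M \<and> m' \<in> carrier M \<and>
        (\<exists>l. (f [^]\<^bsub>R\<^esub> (l + k')) \<odot>\<^bsub>M\<^esub> m = (f [^]\<^bsub>R\<^esub> (l + k)) \<odot>\<^bsub>M\<^esub> m')}"

definition loc_frac ::
    "('a, 'm) ring_scheme \<Rightarrow> ('a, 'b, 'n) module_scheme \<Rightarrow> 'a \<Rightarrow> 'b \<Rightarrow> nat \<Rightarrow> ('b \<times> nat) set" where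
  "loc_frac R M f m k = frac_rel R M f `` {(m, k)}"

definition loc_group ::
    "('a, 'm) ring_scheme \<Rightarrow> ('a, 'b, 'n) module_scheme \<Rightarrow> 'a \<Rightarrow> ('b \<times> nat) set monoid" where
  "loc_group R M f =
     \<lparr>carrier = (carrier M \<times> UNIV) // frac_rel R M f,
      monoid.mult = (\<lambda>u v. \<Union>(m, k)\<in>u. \<Union>(m', k')\<in>v.
        loc_frac R M f ((f [^]\<^bsub>R\<^esub> k') \<odot>\<^bsub>M\<^esub> m \<oplus>\<^bsub>M\<^esub> (f [^]\<^bsub>R\<^esub> k) \<odot>\<^bsub>M\<^esub> m') (k + k')),
      one = loc_frac R M f \<zero>\<^bsub>M\<^esub> 0\<rparr>"

text \<open>The canonical map from \<open>M\<^sub>f\<close> to \<open>M\<^sub>h\<close> for \<open>h = g f\<close>, and the map induced on \<open>M\<^sub>f\<close> by the Frobenius of \<open>M\<close>.\<close>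

definition loc_map ::
    "('a, 'm) ring_scheme \<Rightarrow> ('a, 'b, 'n) module_scheme \<Rightarrow> 'a \<Rightarrow> 'a \<Rightarrow> ('b \<times> nat) set \<Rightarrow> ('b \<times> nat) set" where
  "loc_map R M g h u = (\<Union>(m, k)\<in>u. loc_frac R M h ((g [^]\<^bsub>R\<^esub> k) \<odot>\<^bsub>M\<^esub> m) k)"

definition loc_frob ::
    "('a, 'm) ring_scheme \<Rightarrow> ('a, 'b, 'n) module_scheme \<Rightarrow> nat \<Rightarrow> 'a \<Rightarrow> ('b \<times> nat) set \<Rightarrow> ('b \<times> nat) set" where
  "loc_frob R M p f u = (\<Union>(m, k)\<in>u. loc_frac R M f (m [^]\<^bsub>M\<^esub> p) (p * k))"

text \<open>
  The Cech complex of \<open>M\<close> on a finite sequence \<open>fs\<close> of elements of \<open>R\<close>: in degree \<open>j\<close> it is the product of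
  the \<open>M\<^sub>f\<close>, where \<open>f\<close> runs through the products of \<open>j\<close> members of \<open>fs\<close> at distinct positions.
\<close>

definition cech_index :: "'a list \<Rightarrow> nat \<Rightarrow> nat set set" where
  "cech_index fs j = {I. I \<subseteq> {..<length fs} \<and> card I = j}"

definition prod_at :: "('a, 'm) ring_scheme \<Rightarrow> 'a list \<Rightarrow> nat set \<Rightarrow> 'a" where
  "prod_at R fs I = (\<Otimes>\<^bsub>R\<^esub>i\<in>I. fs ! i)"

definition cech_group ::
    "('a, 'm) ring_scheme \<Rightarrow> ('a, 'b, 'n) module_scheme \<Rightarrow> 'a list \<Rightarrow> nat \<Rightarrow> (nat set \<Rightarrow> ('b \<times> nat) set) monoid" where
  "cech_group R M fs j = product_group (cech_index fs j) (\<lambda>I. loc_group R M (prod_at R fs I))"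

definition cech_diff ::
    "('a, 'm) ring_scheme \<Rightarrow> ('a, 'b, 'n) module_scheme \<Rightarrow> 'a list \<Rightarrow> nat \<Rightarrow>
      (nat set \<Rightarrow> ('b \<times> nat) set) \<Rightarrow> (nat set \<Rightarrow> ('b \<times> nat) set)" where
  "cech_diff R M fs j c =
     (\<lambda>J\<in>cech_index fs (Suc j).
        \<Otimes>\<^bsub>loc_group R M (prod_at R fs J)\<^esub>i\<in>J.
          (let y = loc_map R M (fs ! i) (prod_at R fs J) (c (J - {i}))
           in if even (card {l\<in>J. l < i}) then y else inv\<^bsub>loc_group R M (prod_at R fs J)\<^esub> y))"

definition cech_frob ::
    "('a, 'm) ring_scheme \<Rightarrow> ('a, 'b, 'n) module_scheme \<Rightarrow> nat \<Rightarrow> 'a list \<Rightarrow> nat \<Rightarrow>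
      (nat set \<Rightarrow> ('b \<times> nat) set) \<Rightarrow> (nat set \<Rightarrow> ('b \<times> nat) set)" where
  "cech_frob R M p fs j c = (\<lambda>I\<in>cech_index fs j. loc_frob R M p (prod_at R fs I) (c I))"

definition cocycles ::
    "('a, 'm) ring_scheme \<Rightarrow> ('a, 'b, 'n) module_scheme \<Rightarrow> 'a list \<Rightarrow> nat \<Rightarrow> (nat set \<Rightarrow> ('b \<times> nat) set) monoid" where
  "cocycles R M fs j =
     (cech_group R M fs j)
       \<lparr>carrier := kernel (cech_group R M fs j) (cech_group R M fs (Suc j)) (cech_diff R M fs j)\<rparr>"

definition coboundaries ::
    "('a, 'm) ring_scheme \<Rightarrow> ('a, 'b, 'n) module_scheme \<Rightarrow> 'a list \<Rightarrow> nat \<Rightarrow> (nat set \<Rightarrow> ('b \<times> nat) set) set" where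
  "coboundaries R M fs j =
     (case j of
        0 \<Rightarrow> {\<one>\<^bsub>cech_group R M fs 0\<^esub>}
      | Suc i \<Rightarrow> cech_diff R M fs i ` carrier (cech_group R M fs i))"

text \<open>The local cohomology of \<open>M\<close> with support in the ideal generated by \<open>fs\<close>, and its Frobenius action \<open>\<rho>\<close>.\<close>

definition local_cohomology ::
    "('a, 'm) ring_scheme \<Rightarrow> ('a, 'b, 'n) module_scheme \<Rightarrow> 'a list \<Rightarrow> nat \<Rightarrow> (nat set \<Rightarrow> ('b \<times> nat) set) set monoid" where
  "local_cohomology R M fs j = cocycles R M fs j Mod coboundaries R M fs j"

definition frob_action ::
    "('a, 'm) ring_scheme \<Rightarrow> ('a, 'b, 'n) module_scheme \<Rightarrow> nat \<Rightarrow> 'a list \<Rightarrow> nat \<Rightarrow>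
      (nat set \<Rightarrow> ('b \<times> nat) set) set \<Rightarrow> (nat set \<Rightarrow> ('b \<times> nat) set) set" where
  "frob_action R M p fs j \<xi> =
     (\<Union>c\<in>\<xi>. coboundaries R M fs j #>\<^bsub>cocycles R M fs j\<^esub> cech_frob R M p fs j c)"

text \<open>
  Nilpotency of the local cohomology of \<open>M\<close> with support in \<open>\<mm>\<close>. Over a Noetherian ring \<open>\<mm>\<close> has a finite
  generating sequence, and the Cech cohomology with its Frobenius action does not depend on it up to
  isomorphism; rather than choosing one, all of them are allowed.
\<close>

definition lc_nilpotent ::
    "('a, 'm) ring_scheme \<Rightarrow> 'a set \<Rightarrow> ('a, 'b, 'n) module_scheme \<Rightarrow> nat \<Rightarrow> nat \<Rightarrow> bool" where
  "lc_nilpotent R \<mm> M p j \<longleftrightarrow>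
     (\<forall>fs. set fs \<subseteq> carrier R \<and> Idl\<^bsub>R\<^esub> (set fs) = \<mm> \<longrightarrow>
        (\<forall>\<xi>\<in>carrier (local_cohomology R M fs j).
           \<exists>e. (frob_action R M p fs j ^^ e) \<xi> = \<one>\<^bsub>local_cohomology R M fs j\<^esub>))"


section \<open>F-depth and weak F-nilpotence\<close>

definition Fdepth ::
    "('a, 'm) ring_scheme \<Rightarrow> 'a set \<Rightarrow> ('a, 'b, 'n) module_scheme \<Rightarrow> nat \<Rightarrow> enat" where
  "Fdepth R \<mm> M p = Inf {enat j | j. \<not> lc_nilpotent R \<mm> M p j}"

definition regular_element :: "('a, 'm) ring_scheme \<Rightarrow> 'a \<Rightarrow> bool" where
  "regular_element R x \<longleftrightarrow>
     x \<in> carrier R \<and> (\<forall>r\<in>carrier R. x \<otimes>\<^bsub>R\<^esub> r = \<zero>\<^bsub>R\<^esub> \<longrightarrow> r = \<zero>\<^bsub>R\<^esub>)"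

text \<open>
  The 1 is moved to the other side of the equation because subtraction on \<^typ>\<open>enat\<close> is truncated
  at 0.
\<close>

definition F_depth_element :: "('a, 'm) ring_scheme \<Rightarrow> 'a set \<Rightarrow> nat \<Rightarrow> 'a \<Rightarrow> bool" where
  "F_depth_element R \<mm> p x \<longleftrightarrow>
     regular_element R x \<and>
     Fdepth R \<mm> (algebra_via (\<lambda>r. PIdl\<^bsub>R\<^esub> x +>\<^bsub>R\<^esub> r) (R Quot PIdl\<^bsub>R\<^esub> x)) p + 1
       = Fdepth R \<mm> (algebra_via id R) p"

definition weakly_F_nilpotent_local :: "('a, 'm) ring_scheme \<Rightarrow> nat \<Rightarrow> bool" where
  "weakly_F_nilpotent_local A p \<longleftrightarrow>
     noetherian_local_ring A p \<and>
     (\<forall>j. enat j < krull_dim A \<longrightarrow> lc_nilpotent A (the_max_ideal A) (algebra_via id A) p j)"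

definition weakly_F_nilpotent_graded ::
    "('a, 'm) ring_scheme \<Rightarrow> (nat \<Rightarrow> 'a set) \<Rightarrow> nat \<Rightarrow> bool" where
  "weakly_F_nilpotent_graded A G p \<longleftrightarrow>
     graded_ring A G p \<and>
     (\<forall>j. enat j < krull_dim A \<longrightarrow> lc_nilpotent A (homog_max_ideal A G) (algebra_via id A) p j)"

end

theory Submission
  imports Defs
begin

text \<open>
  Weak \<open>F\<close>-nilpotence of \<open>A = R/xR\<close> says \<open>Fdepth A \<ge> dim A\<close>, so
  \<open>Fdepth R = Fdepth A + 1 \<ge> dim A + 1\<close>, and it remains to see that \<open>dim R \<le> dim A + 1\<close>. By Krull's
  principal ideal theorem a chain of primes that ends in a prime containing \<open>x\<close> can be modified so
  that already its second member contains \<open>x\<close>; the members from there on give a chain in \<open>A\<close>. In the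
  local case every chain may be assumed to end in \<open>\<mm>\<close>. In the graded case, passing from a prime \<open>P\<close> to
  the largest homogeneous ideal \<open>P\<^sup>*\<close> in it lowers the height by at most one, and if \<open>x \<notin> P\<close> then
  \<open>P\<^sup>* + xR\<close> is a proper ideal strictly larger than \<open>P\<^sup>*\<close>, which restores the length.
\<close>

section \<open>Ideals\<close>

text \<open>The F-depth of \<open>R/xR\<close> is measured over \<open>R\<close>, its weak
  F-nilpotence over \<open>R/xR\<close> itself, so a change of rings is the only cohomological work.
  As \<open>lc_nilpotent\<close> ranges over all generating sequences, it is enough that generators
  of \<open>\<mm>\<close> map to generators of its image; no two sequences have to be compared. A
  chain of primes of \<open>R\<close> may avoid \<open>x\<close> up to its last member, so the
  correspondence of primes alone does not bound the dimension of \<open>R\<close>. Localizations in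
  Krull's theorem are replaced by saturated ideals of \<open>R\<close>, so that all chain conditions
  are stated inside one ring. A graded ring may have maximal ideals that do not contain
  \<open>x\<close>, hence the top of a chain cannot simply be enlarged to contain it. As the degree
  zero part is only local, not a field, the properness of \<open>P\<^sup>* + xR\<close> needs an
  argument in degree zero. That \<open>xR\<close> itself is proper comes from the condition
  \<open>\<one> \<noteq> \<zero>\<close> in the characteristic of the quotient.\<close>

locale noetherian_cring = cring + noetherian_ring

lemma (in cring) mem_ideal_sum_PIdl_iff:
  "z \<in> I <+>\<^bsub>R\<^esub> PIdl a \<longleftrightarrow> (\<exists>i\<in>I. \<exists>r\<in>carrier R. z = i \<oplus> r \<otimes> a)"
  by (auto simp: set_add_def' cgenideal_def)

lemma (in cring) ideal_sum_PIdl: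
  assumes I: "ideal I R" and a: "a \<in> carrier R"
  shows "ideal (I <+>\<^bsub>R\<^esub> PIdl a) R" "I \<subseteq> I <+>\<^bsub>R\<^esub> PIdl a" "a \<in> I <+>\<^bsub>R\<^esub> PIdl a"
proof -
  interpret I: ideal I R by fact
  show "ideal (I <+>\<^bsub>R\<^esub> PIdl a) R"
    using add_ideals[OF I cgenideal_ideal[OF a]] .
  show "I \<subseteq> I <+>\<^bsub>R\<^esub> PIdl a"
  proof
    fix i assume i: "i \<in> I"
    then have "i = i \<oplus> \<zero> \<otimes> a" using a I.Icarr by simp
    then show "i \<in> I <+>\<^bsub>R\<^esub> PIdl a"
      unfolding mem_ideal_sum_PIdl_iff using i by blast
  qed
  have "a = \<zero> \<oplus> \<one> \<otimes> a" using a by simp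
  then show "a \<in> I <+>\<^bsub>R\<^esub> PIdl a"
    unfolding mem_ideal_sum_PIdl_iff using I.zero_closed by blast
qed

text \<open>Zorn's lemma applies because a nonempty chain of ideals in a Noetherian ring contains
  its own union. This is the form in which Noetherian induction is used below.\<close>

lemma (in noetherian_ring) maximal_ideal_in_family:
  assumes "F \<noteq> {}" and ideals: "\<And>I. I \<in> F \<Longrightarrow> ideal I R"
  shows "\<exists>M\<in>F. \<forall>I\<in>F. M \<subseteq> I \<longrightarrow> I = M"
proof (rule subset_Zorn_nonempty[OF assms(1)])
  fix C assume C: "C \<noteq> {}" "subset.chain F C"
  then have "subset.chain {I. ideal I R} C"
    using ideals unfolding pred_on.chain_def by auto
  then show "\<Union>C \<in> F"
    using ideal_chain_is_trivial[OF C(1)] C(2) by (auto simp: pred_on.chain_def)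
qed

lemma (in ring) proper_ideal_in_maximalideal:
  assumes I: "ideal I R" "I \<noteq> carrier R"
  obtains M where "maximalideal M R" "I \<subseteq> M"
proof -
  \<comment> \<open>Properness is recorded as \<open>\<one> \<notin> J\<close>, a condition that
    passes to unions of chains.\<close>
  let ?F = "{J. ideal J R \<and> I \<subseteq> J \<and> \<one> \<notin> J}"
  have "I \<in> ?F" using I ideal.one_imp_carrier by auto
  have "\<exists>M\<in>?F. \<forall>J\<in>?F. M \<subseteq> J \<longrightarrow> J = M"
  proof (rule subset_Zorn_nonempty)
    show "?F \<noteq> {}" using \<open>I \<in> ?F\<close> by auto
    fix C assume C: "C \<noteq> {}" "subset.chain ?F C"
    then have "subset.chain {I. ideal I R} C" unfolding pred_on.chain_def by auto
    then have "ideal (\<Union>C) R" using chain_Union_is_ideal[of C] C(1) by simp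
    then show "\<Union>C \<in> ?F" using C unfolding pred_on.chain_def by auto
  qed
  then obtain M where MF: "M \<in> ?F" and max: "\<forall>J\<in>?F. M \<subseteq> J \<longrightarrow> J = M" by (rule bexE)
  from MF have M: "ideal M R" "I \<subseteq> M" "\<one> \<notin> M" by simp_all
  have "maximalideal M R"
  proof (rule maximalidealI)
    fix J assume J: "ideal J R" "M \<subseteq> J" "J \<subseteq> carrier R"
    then show "J = M \<or> J = carrier R"
      using max[rule_format, of J] M ideal.one_imp_carrier[OF J(1)] by auto
  qed (use M in auto)
  with M that show thesis by blast
qed

section \<open>Krull's principal ideal theorem\<close>

text \<open>Contraction to \<open>R\<close> of the extension of \<open>J\<close> to the localization of \<open>R\<close> at \<open>P\<close>.\<close>

definition (in cring) saturation :: "'a set \<Rightarrow> 'a set \<Rightarrow> 'a set" where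
  "saturation P J = {r \<in> carrier R. \<exists>s\<in>carrier R - P. s \<otimes> r \<in> J}"

context cring
begin

lemma mem_saturationI:
  "r \<in> carrier R \<Longrightarrow> s \<in> carrier R \<Longrightarrow> s \<notin> P \<Longrightarrow> s \<otimes> r \<in> J \<Longrightarrow> r \<in> saturation P J"
  by (auto simp: saturation_def)

lemma saturation_ideal:
  assumes P: "primeideal P R" and J: "ideal J R"
  shows "ideal (saturation P J) R"
proof (rule idealI)
  interpret P: primeideal P R by fact
  interpret J: ideal J R by fact
  show "ring R" ..
  have one: "\<one> \<notin> P" using P.I_notcarr P.one_imp_carrier by blast
  have mult: "x \<otimes> a \<in> saturation P J" if a: "a \<in> saturation P J" and x: "x \<in> carrier R" for a x
  proof -
    from a obtain s where s: "s \<in> carrier R" "s \<notin> P" "s \<otimes> a \<in> J" "a \<in> carrier R"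
      by (auto simp: saturation_def)
    have "s \<otimes> (x \<otimes> a) = x \<otimes> (s \<otimes> a)" using s x by algebra
    then show ?thesis using s x J.I_l_closed[of "s \<otimes> a" x] by (intro mem_saturationI[of _ s]) auto
  qed
  then show "\<And>a x. a \<in> saturation P J \<Longrightarrow> x \<in> carrier R \<Longrightarrow> x \<otimes> a \<in> saturation P J" .
  show "a \<otimes> x \<in> saturation P J" if "a \<in> saturation P J" "x \<in> carrier R" for a x
    using mult[OF that] that m_comm[of a x] by (auto simp: saturation_def)
  show "subgroup (saturation P J) (add_monoid R)"
  proof (rule add.subgroupI)
    show "saturation P J \<subseteq> carrier R" by (auto simp: saturation_def)
    have "\<zero> \<in> saturation P J" using one by (intro mem_saturationI[of _ \<one>]) auto
    then show "saturation P J \<noteq> {}" by blast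
    fix a assume a: "a \<in> saturation P J"
    then have ac: "a \<in> carrier R" by (auto simp: saturation_def)
    have "\<ominus> a = \<ominus> \<one> \<otimes> a" using ac by algebra
    then show "\<ominus> a \<in> saturation P J" using mult[OF a, of "\<ominus> \<one>"] by simp
    fix b assume b: "b \<in> saturation P J"
    from a obtain s where s: "s \<in> carrier R" "s \<notin> P" "s \<otimes> a \<in> J" by (auto simp: saturation_def)
    from b obtain t where t: "t \<in> carrier R" "t \<notin> P" "t \<otimes> b \<in> J" "b \<in> carrier R"
      by (auto simp: saturation_def)
    have "(s \<otimes> t) \<otimes> (a \<oplus> b) = t \<otimes> (s \<otimes> a) \<oplus> s \<otimes> (t \<otimes> b)" using s t ac by algebra
    also have "\<dots> \<in> J" using s t ac by (simp add: J.I_l_closed J.a_closed)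
    finally show "a \<oplus> b \<in> saturation P J"
      using s t ac P.I_prime by (intro mem_saturationI[of _ "s \<otimes> t"]) auto
  qed
qed

lemma saturation_mono: "J \<subseteq> K \<Longrightarrow> saturation P J \<subseteq> saturation P K"
  by (auto simp: saturation_def)

lemma subset_saturation:
  assumes "primeideal P R" "ideal J R"
  shows "J \<subseteq> saturation P J"
proof
  interpret P: primeideal P R by fact
  interpret J: ideal J R by fact
  fix a assume "a \<in> J"
  then show "a \<in> saturation P J"
    using P.I_notcarr P.one_imp_carrier J.Icarr
    by (intro mem_saturationI[of _ \<one>]) auto
qed

lemma saturation_idem:
  assumes P: "primeideal P R" and J: "ideal J R"
  shows "saturation P (saturation P J) = saturation P J"
proof
  interpret P: primeideal P R by fact
  show "saturation P (saturation P J) \<subseteq> saturation P J"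
  proof
    fix a assume "a \<in> saturation P (saturation P J)"
    then obtain s t where "s \<in> carrier R" "s \<notin> P" "t \<in> carrier R" "t \<notin> P" "a \<in> carrier R"
      "t \<otimes> (s \<otimes> a) \<in> J" by (auto simp: saturation_def)
    then show "a \<in> saturation P J"
      using P.I_prime by (intro mem_saturationI[of _ "t \<otimes> s"]) (auto simp: m_assoc)
  qed
qed (rule subset_saturation[OF P saturation_ideal[OF P J]])

lemma saturation_eq_carrier:
  assumes "primeideal P R" "ideal J R" "\<not> J \<subseteq> P"
  shows "saturation P J = carrier R"
proof -
  interpret J: ideal J R by fact
  from assms obtain s where s: "s \<in> J" "s \<notin> P" by blast
  have "r \<in> saturation P J" if "r \<in> carrier R" for r
    using s that J.Icarr J.I_r_closed by (intro mem_saturationI[of _ s]) auto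
  then show ?thesis by (auto simp: saturation_def)
qed

text \<open>For a prime \<open>P\<close> the ideals fixed by \<open>saturation P\<close> correspond
  to the ideals of the localization \<open>R_P\<close>, so this says that \<open>R_P/I R_P\<close>
  is Artinian.\<close>

definition saturated_dcc :: "'a set \<Rightarrow> 'a set \<Rightarrow> bool" where
  "saturated_dcc P I \<longleftrightarrow>
     (\<forall>J :: nat \<Rightarrow> 'a set.
        (\<forall>n. ideal (J n) R \<and> I \<subseteq> J n \<and> saturation P (J n) = J n \<and> J (Suc n) \<subseteq> J n) \<longrightarrow>
        (\<exists>N. \<forall>n\<ge>N. J n = J N))"

lemma saturated_dccD:
  assumes "saturated_dcc P I"
    and "\<And>n. ideal (J n) R" "\<And>n. I \<subseteq> J n" "\<And>n. saturation P (J n) = J n" "\<And>n. J (Suc n) \<subseteq> J n"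
  shows "\<exists>N. \<forall>n\<ge>N. J n = J N"
  using assms unfolding saturated_dcc_def by metis

lemma colon_ideal:
  assumes J: "ideal J R" and a: "a \<in> carrier R"
  shows "ideal {r \<in> carrier R. r \<otimes> a \<in> J} R"
proof (rule idealI)
  interpret J: ideal J R by fact
  show "ring R" ..
  show "subgroup {r \<in> carrier R. r \<otimes> a \<in> J} (add_monoid R)"
    using a by (intro add.subgroupI) (auto simp: l_distr l_minus)
  fix b x assume "b \<in> {r \<in> carrier R. r \<otimes> a \<in> J}" "x \<in> carrier R"
  moreover from this have "b \<otimes> x \<otimes> a = x \<otimes> (b \<otimes> a)" "x \<otimes> b \<otimes> a = x \<otimes> (b \<otimes> a)"
    using a by (simp_all add: m_ac)
  ultimately show "b \<otimes> x \<in> {r \<in> carrier R. r \<otimes> a \<in> J}" "x \<otimes> b \<in> {r \<in> carrier R. r \<otimes> a \<in> J}"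
    using J.I_l_closed by auto
qed

lemma saturation_colon:
  assumes "saturation P J = J" "a \<in> carrier R"
  shows "saturation P {r \<in> carrier R. r \<otimes> a \<in> J} \<subseteq> {r \<in> carrier R. r \<otimes> a \<in> J}"
proof
  fix r assume "r \<in> saturation P {r \<in> carrier R. r \<otimes> a \<in> J}"
  then obtain s where s: "r \<in> carrier R" "s \<in> carrier R" "s \<notin> P" "s \<otimes> (r \<otimes> a) \<in> J"
    using assms(2) by (auto simp: saturation_def m_assoc)
  then have "r \<otimes> a \<in> saturation P J" using assms(2) by (intro mem_saturationI[of _ s]) auto
  with s assms(1) show "r \<in> {r \<in> carrier R. r \<otimes> a \<in> J}" by simp
qed

text \<open>Exactness of \<open>0 \<rightarrow> R/(I : a) \<rightarrow> R/I \<rightarrow> R/(I + aR) \<rightarrow> 0\<close>, in terms of chains of ideals.\<close>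

lemma saturated_dcc_extension:
  assumes P: "primeideal P R" and I: "ideal I R" and a: "a \<in> carrier R"
    and sum: "saturated_dcc P (I <+>\<^bsub>R\<^esub> PIdl a)"
    and colon: "saturated_dcc P {r \<in> carrier R. r \<otimes> a \<in> I}"
  shows "saturated_dcc P I"
  unfolding saturated_dcc_def
proof (intro allI impI)
  fix J assume *: "\<forall>n::nat. ideal (J n) R \<and> I \<subseteq> J n \<and> saturation P (J n) = J n \<and> J (Suc n) \<subseteq> J n"
  then have J: "ideal (J n) R" "I \<subseteq> J n" "saturation P (J n) = J n" "J (Suc n) \<subseteq> J n" for n
    by blast+
  have anti: "J n \<subseteq> J m" if "m \<le> n" for m n
    using lift_Suc_antimono_le[of J, OF J(4) that] .
  let ?S = "\<lambda>n. saturation P (J n <+>\<^bsub>R\<^esub> PIdl a)" and ?C = "\<lambda>n. {r \<in> carrier R. r \<otimes> a \<in> J n}"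
  have S: "ideal (?S n) R" "I <+>\<^bsub>R\<^esub> PIdl a \<subseteq> ?S n" "saturation P (?S n) = ?S n" "?S (Suc n) \<subseteq> ?S n" for n
  proof -
    note Ja = ideal_sum_PIdl[OF J(1) a, of n]
    show "ideal (?S n) R" using saturation_ideal[OF P Ja(1)] .
    have "I <+>\<^bsub>R\<^esub> PIdl a \<subseteq> J n <+>\<^bsub>R\<^esub> PIdl a" using J(2)[of n] unfolding subset_iff mem_ideal_sum_PIdl_iff by blast
    then show "I <+>\<^bsub>R\<^esub> PIdl a \<subseteq> ?S n" using subset_saturation[OF P Ja(1)] by blast
    show "saturation P (?S n) = ?S n" using saturation_idem[OF P Ja(1)] .
    show "?S (Suc n) \<subseteq> ?S n"
      using J(4)[of n] by (intro saturation_mono) (unfold subset_iff mem_ideal_sum_PIdl_iff, blast)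
  qed
  from saturated_dccD[of _ _ ?S, OF sum S] obtain N where N: "\<forall>n\<ge>N. ?S n = ?S N" by (rule exE)
  have C: "ideal (?C n) R" "{r \<in> carrier R. r \<otimes> a \<in> I} \<subseteq> ?C n" "saturation P (?C n) = ?C n" "?C (Suc n) \<subseteq> ?C n" for n
  proof -
    show "ideal (?C n) R" by (rule colon_ideal[OF J(1) a])
    show "{r \<in> carrier R. r \<otimes> a \<in> I} \<subseteq> ?C n" using J(2)[of n] by blast
    show "saturation P (?C n) = ?C n"
      using saturation_colon[OF J(3) a] subset_saturation[OF P colon_ideal[OF J(1) a]] by (rule equalityI)
    show "?C (Suc n) \<subseteq> ?C n" using J(4)[of n] by blast
  qed
  from saturated_dccD[of _ _ ?C, OF colon C] obtain N' where N': "\<forall>n\<ge>N'. ?C n = ?C N'" by (rule exE)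
  define m where "m = max N N'"
  have "J n = J m" if n: "n \<ge> m" for n
  proof
    show "J n \<subseteq> J m" using anti[OF n] .
    interpret Jn: ideal "J n" R by (rule J)
    interpret Jm: ideal "J m" R by (rule J)
    show "J m \<subseteq> J n"
    proof
      fix j assume j: "j \<in> J m"
      have "?S m = ?S n" using N[rule_format, of m] N[rule_format, of n] n by (simp add: m_def)
      moreover have "j \<in> ?S m"
        using j subset_saturation[OF P ideal_sum_PIdl(1)[OF J(1) a]] ideal_sum_PIdl(2)[OF J(1) a] by blast
      ultimately have "j \<in> ?S n" by simp
      then obtain s i r where s: "s \<in> carrier R" "s \<notin> P" and i: "i \<in> J n" and r: "r \<in> carrier R"
        and eq: "s \<otimes> j = i \<oplus> r \<otimes> a" and jc: "j \<in> carrier R"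
        by (auto simp: saturation_def mem_ideal_sum_PIdl_iff)
      have ic: "i \<in> carrier R" using i by simp
      \<comment> \<open>The multiple of \<open>a\<close> is isolated to see that \<open>r\<close>
        lies in the colon ideal of \<open>J m\<close>, which agrees with that of
        \<open>J n\<close>.\<close>
      have "r \<otimes> a = (i \<oplus> r \<otimes> a) \<ominus> i" using ic r a by algebra
      also have "\<dots> \<in> J m" using j i s anti[OF n] Jm.I_l_closed[OF j s(1)] unfolding eq[symmetric] a_minus_def
        by (intro Jm.a_closed Jm.a_inv_closed) auto
      finally have "r \<in> ?C m" using r by simp
      moreover have "?C m = ?C n" using N'[rule_format, of m] N'[rule_format, of n] n by (simp add: m_def)
      ultimately have "r \<otimes> a \<in> J n" by blast
      then have "s \<otimes> j \<in> J n" using i eq by simp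
      then have "j \<in> saturation P (J n)" using s jc by (intro mem_saturationI[of _ s]) auto
      then show "j \<in> J n" using J(3) by simp
    qed
  qed
  then show "\<exists>N. \<forall>n\<ge>N. J n = J N" by blast
qed

end

text \<open>Noetherian induction: an ideal maximal among those violating the chain condition is prime.\<close>

lemma (in noetherian_cring) saturated_dcc_of_minimal_prime:
  assumes P: "primeideal P R" and K: "ideal K R"
    and minimal: "\<And>I. primeideal I R \<Longrightarrow> K \<subseteq> I \<Longrightarrow> I \<subseteq> P \<Longrightarrow> I = P"
  shows "saturated_dcc P K"
proof (rule ccontr)
  assume notK: "\<not> saturated_dcc P K"
  let ?F = "{I. ideal I R \<and> K \<subseteq> I \<and> \<not> saturated_dcc P I}"
  have "\<exists>I\<in>?F. \<forall>J\<in>?F. I \<subseteq> J \<longrightarrow> J = I"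
    using K notK by (intro maximal_ideal_in_family) blast+
  then obtain I where IF: "I \<in> ?F" and max: "\<forall>J\<in>?F. I \<subseteq> J \<longrightarrow> J = I" by (rule bexE)
  from IF have I: "ideal I R" "K \<subseteq> I" "\<not> saturated_dcc P I" by simp_all
  interpret I: ideal I R by fact
  \<comment> \<open>An ideal not inside \<open>P\<close> saturates to the whole ring, where the
    chain condition is trivial.\<close>
  have IP: "I \<subseteq> P"
  proof (rule ccontr)
    assume "\<not> I \<subseteq> P"
    then have "J n = J m" if "\<forall>n. ideal (J n) R \<and> I \<subseteq> J n \<and> saturation P (J n) = J n \<and> J (Suc n) \<subseteq> J n"
      for J :: "nat \<Rightarrow> 'a set" and n m
      using that saturation_eq_carrier[OF P, of "J n"] saturation_eq_carrier[OF P, of "J m"] by blast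
    then have "saturated_dcc P I" unfolding saturated_dcc_def by blast
    with I show False by simp
  qed
  interpret P: primeideal P R by fact
  have "primeideal I R"
  proof (rule primeidealI[OF I(1) is_cring])
    show "carrier R \<noteq> I" using IP P.I_notcarr P.a_subset by blast
    fix a b assume a: "a \<in> carrier R" and b: "b \<in> carrier R" and ab: "a \<otimes> b \<in> I"
    show "a \<in> I \<or> b \<in> I"
    proof (rule ccontr)
      assume n: "\<not> (a \<in> I \<or> b \<in> I)"
      \<comment> \<open>Both \<open>I + aR\<close> and the colon ideal are strictly larger than
        \<open>I\<close>, the latter because it contains \<open>b\<close>; maximality gives them the
        chain condition.\<close>
      have sum: "saturated_dcc P (I <+>\<^bsub>R\<^esub> PIdl a)"
        using max ideal_sum_PIdl[OF I(1) a] n I(2) by blast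
      have "I \<subseteq> {r \<in> carrier R. r \<otimes> a \<in> I}" using a I.I_r_closed by auto
      moreover have "b \<in> {r \<in> carrier R. r \<otimes> a \<in> I}" using a b ab m_comm by simp
      ultimately have "saturated_dcc P {r \<in> carrier R. r \<otimes> a \<in> I}"
        using max colon_ideal[OF I(1) a] n I(2) by blast
      with sum show False
        using saturated_dcc_extension[OF P I(1) a] I(3) by blast
    qed
  qed
  then have "I = P" using minimal I IP by blast
  \<comment> \<open>Only two saturated ideals lie above \<open>I = P\<close>: they match the zero
    and the unit ideal of the residue field.\<close>
  have two: "J = P \<or> J = carrier R" if "ideal J R" "I \<subseteq> J" "saturation P J = J" for J
    using that saturation_eq_carrier[OF P, of J] \<open>I = P\<close> by blast
  have "saturated_dcc P I"
    unfolding saturated_dcc_def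
  proof (intro allI impI)
    fix J assume *: "\<forall>n::nat. ideal (J n) R \<and> I \<subseteq> J n \<and> saturation P (J n) = J n \<and> J (Suc n) \<subseteq> J n"
    then have anti: "J n \<subseteq> J m" if "m \<le> n" for m n
      using lift_Suc_antimono_le[of J, OF _ that] by blast
    have two: "J n = P \<or> J n = carrier R" for n using * two by blast
    show "\<exists>N. \<forall>n\<ge>N. J n = J N"
    proof (cases "\<exists>N. J N = P")
      case True
      then obtain N where N: "J N = P" ..
      have "J n = J N" if "n \<ge> N" for n
        using two[of n] anti[OF that] N P.I_notcarr P.a_subset by blast
      then show ?thesis by blast
    next
      case False
      then show ?thesis using two by metis
    qed
  qed
  with I show False by simp
qed

section \<open>Nakayama's lemma and the principal ideal theorem\<close>

context cring
begin

lemma saturation_antimono_prime: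
  "Q \<subseteq> P \<Longrightarrow> saturation P J \<subseteq> saturation Q J"
  by (auto simp: saturation_def)

text \<open>A smaller prime admits more denominators, so saturation with respect to it is the
  stronger condition.\<close>

lemma saturation_fixed_of_subset:
  assumes "primeideal P R" "ideal J R" "Q \<subseteq> P" "saturation Q J = J"
  shows "saturation P J = J"
  using saturation_antimono_prime[OF assms(3), of J] subset_saturation[OF assms(1,2)] assms(4)
  by blast

lemma ideal_sum_PIdl_subset:
  assumes "ideal J R" "I \<subseteq> J" "a \<in> J"
  shows "I <+>\<^bsub>R\<^esub> PIdl a \<subseteq> J"
proof
  interpret J: ideal J R by fact
  fix z assume "z \<in> I <+>\<^bsub>R\<^esub> PIdl a"
  then show "z \<in> J"
    using assms(2,3) J.I_l_closed J.a_closed by (auto simp: mem_ideal_sum_PIdl_iff)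
qed

text \<open>In the localization at \<open>P\<close>: a unit minus a nonunit is a unit. Nakayama's
  lemma and the end of Krull's theorem both cancel such a factor.\<close>

lemma prime_not_mem_minus:
  assumes "primeideal P R" "s \<in> carrier R" "s \<notin> P" "t \<in> P"
  shows "s \<ominus> t \<notin> P"
proof
  interpret P: primeideal P R by fact
  assume "s \<ominus> t \<in> P"
  then have "(s \<ominus> t) \<oplus> t \<in> P" using assms(4) by (rule P.a_closed)
  moreover have "(s \<ominus> t) \<oplus> t = s" using assms(2) P.Icarr[OF assms(4)] by algebra
  ultimately show False using assms(3) by simp
qed

lemma prime_mem_of_pow_mem:
  assumes "primeideal P R" "y \<in> carrier R" "y [^] (n::nat) \<in> P"
  shows "y \<in> P"
proof -
  interpret P: primeideal P R by fact
  show ?thesis using assms(3)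
  proof (induction n)
    case 0
    then show ?case using P.I_notcarr P.one_imp_carrier by auto
  next
    case (Suc n)
    then show ?case using P.I_prime[of "y [^] n" y] assms(2) by auto
  qed
qed

end

text \<open>Nakayama's lemma for \<open>M/L\<close> over the localization at \<open>P\<close>. Instead of the determinant argument,
  compare \<open>M\<close> with a saturated ideal that is maximal among those properly between \<open>L\<close> and \<open>M\<close>.\<close>

lemma (in noetherian_cring) saturated_nakayama:
  assumes P: "primeideal P R" and x: "x \<in> P"
    and L: "ideal L R" "saturation P L = L" and M: "ideal M R" "saturation P M = M"
    and LM: "L \<subseteq> M"
    and gen: "\<And>r. r \<in> M \<Longrightarrow> \<exists>s\<in>carrier R - P. \<exists>l\<in>L. \<exists>t\<in>M. s \<otimes> r = l \<oplus> t \<otimes> x"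
  shows "M = L"
proof (rule ccontr)
  assume ne: "M \<noteq> L"
  interpret P: primeideal P R by fact
  interpret M: ideal M R by fact
  have xc: "x \<in> carrier R" using x by simp
  let ?F = "{J. ideal J R \<and> L \<subseteq> J \<and> J \<subseteq> M \<and> J \<noteq> M \<and> saturation P J = J}"
  have "\<exists>J\<in>?F. \<forall>J'\<in>?F. J \<subseteq> J' \<longrightarrow> J' = J"
    using L LM ne by (intro maximal_ideal_in_family) auto
  then obtain J where JF: "J \<in> ?F" and max: "\<forall>J'\<in>?F. J \<subseteq> J' \<longrightarrow> J' = J" by (rule bexE)
  from JF have J: "ideal J R" "L \<subseteq> J" "J \<subseteq> M" "J \<noteq> M" "saturation P J = J" by simp_all
  interpret J: ideal J R by (rule J)
  have sat: "r \<in> J" if "r \<in> carrier R" "s \<in> carrier R" "s \<notin> P" "s \<otimes> r \<in> J" for r s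
    using mem_saturationI[OF that] J(5) by simp
  show False
  proof (cases "\<forall>t\<in>M. t \<otimes> x \<in> J")
    case True
    \<comment> \<open>Here \<open>gen\<close> puts a denominator times each element of
      \<open>M\<close> into \<open>J\<close>.\<close>
    have "r \<in> J" if r: "r \<in> M" for r
    proof -
      obtain s l t where s: "s \<in> carrier R" "s \<notin> P" and "l \<in> L" "t \<in> M" "s \<otimes> r = l \<oplus> t \<otimes> x"
        using gen[OF r] by blast
      then have "s \<otimes> r \<in> J" using True J(2) by auto
      with s show "r \<in> J" using sat[of r s] M.Icarr[OF r] by simp
    qed
    with J(3,4) show False by blast
  next
    case False
    then obtain t where t: "t \<in> M" "t \<otimes> x \<notin> J" by blast
    have tc: "t \<in> carrier R" using t by simp
    let ?K = "J <+>\<^bsub>R\<^esub> PIdl (t \<otimes> x)"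
    have txc: "t \<otimes> x \<in> carrier R" using tc xc by simp
    note K = ideal_sum_PIdl[OF J(1) txc]
    have sub: "?K \<subseteq> saturation P ?K" by (rule subset_saturation[OF P K(1)])
    have "?K \<subseteq> M" using t(1) xc J(3) M.I_r_closed by (intro ideal_sum_PIdl_subset[OF M(1)]) auto
    then have KM: "saturation P ?K \<subseteq> M" using saturation_mono[of ?K M P] M(2) by simp
    \<comment> \<open>Otherwise this would be a member of the family strictly above the maximal
      \<open>J\<close>, since it contains \<open>t \<otimes> x\<close>.\<close>
    have "saturation P ?K = M"
    proof (rule ccontr)
      assume "saturation P ?K \<noteq> M"
      then have "saturation P ?K \<in> ?F"
        using saturation_ideal[OF P K(1)] saturation_idem[OF P K(1)] KM sub K(2) J(2) by auto
      then have "saturation P ?K = J" using max sub K(2) by blast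
      then show False using sub K(3) t(2) by blast
    qed
    with t obtain s j r where s: "s \<in> carrier R" "s \<notin> P" and j: "j \<in> J" and r: "r \<in> carrier R"
      and eq: "s \<otimes> t = j \<oplus> r \<otimes> (t \<otimes> x)"
      by (auto simp: saturation_def mem_ideal_sum_PIdl_iff)
    have jc: "j \<in> carrier R" using j by simp
    \<comment> \<open>Since \<open>x \<in> P\<close>, the factor
      \<open>s \<ominus> r \<otimes> x\<close> is still a denominator, so it can be cancelled modulo
      the saturated ideal \<open>J\<close>.\<close>
    have "(s \<ominus> r \<otimes> x) \<otimes> t = s \<otimes> t \<ominus> r \<otimes> (t \<otimes> x)" using s r tc xc by algebra
    also have "\<dots> = j" unfolding eq using jc r tc xc by algebra
    finally have "(s \<ominus> r \<otimes> x) \<otimes> t \<in> J" using j by simp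
    moreover have "s \<ominus> r \<otimes> x \<notin> P" using s r x P.I_l_closed by (intro prime_not_mem_minus[OF P]) auto
    ultimately have "t \<in> J" using s r xc tc by (intro sat[of t "s \<ominus> r \<otimes> x"]) auto
    then show False using t(2) xc J.I_r_closed by blast
  qed
qed

text \<open>If there is no such \<open>Q\<close>, then \<open>P2\<close> is minimal over
  \<open>P0\<close> and \<open>x\<close>, the localization at \<open>P2\<close> modulo both is
  Artinian, and the ideals \<open>E n\<close> become stationary. Nakayama's lemma transfers this to
  the \<open>D n\<close>. Then, up to a denominator outside \<open>P1\<close>,
  \<open>y [^] N\<close> is a multiple of \<open>y [^] Suc N\<close> modulo \<open>P0\<close>, which
  is absurd for \<open>y\<close> in \<open>P1\<close> but not in \<open>P0\<close>.\<close>

theorem (in noetherian_cring) krull_principal_ideal_theorem: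
  assumes P0: "primeideal P0 R" and P1: "primeideal P1 R" and P2: "primeideal P2 R"
    and P01: "P0 \<subset> P1" and P12: "P1 \<subset> P2" and x: "x \<in> P2" "x \<notin> P1"
  shows "\<exists>Q. primeideal Q R \<and> P0 \<subset> Q \<and> Q \<subset> P2 \<and> x \<in> Q"
proof (rule ccontr)
  assume no: "\<not> ?thesis"
  interpret P0: primeideal P0 R by fact
  interpret P1: primeideal P1 R by fact
  interpret P2: primeideal P2 R by fact
  have xc: "x \<in> carrier R" using x by simp
  let ?K = "P0 <+>\<^bsub>R\<^esub> PIdl x"
  note K = ideal_sum_PIdl[OF P0.is_ideal xc]
  have dcc: "saturated_dcc P2 ?K"
    using no K(2,3) P01 x by (intro saturated_dcc_of_minimal_prime[OF P2 K(1)]) blast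
  obtain y where y: "y \<in> P1" "y \<notin> P0" using P01 by blast
  have yc: "y \<in> carrier R" using y by simp
  let ?Y = "\<lambda>n. P0 <+>\<^bsub>R\<^esub> PIdl (y [^] (n::nat))"
  \<comment> \<open>The role of the symbolic powers of \<open>P1\<close> is played by powers of the
    single element \<open>y\<close>, contracted from the localization at \<open>P1\<close>.\<close>
  define D where "D n = saturation P1 (?Y n)" for n
  define E where "E n = saturation P2 (D n <+>\<^bsub>R\<^esub> PIdl x)" for n
  note Y = ideal_sum_PIdl[OF P0.is_ideal nat_pow_closed[OF yc]]
  have YD: "?Y n \<subseteq> D n" for n
    unfolding D_def by (rule subset_saturation[OF P1 Y(1)])
  have D: "ideal (D n) R" "saturation P1 (D n) = D n" for n
    unfolding D_def by (rule saturation_ideal[OF P1 Y(1)] saturation_idem[OF P1 Y(1)])+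
  have D2: "saturation P2 (D n) = D n" for n
    using P12 by (intro saturation_fixed_of_subset[OF P2 D(1) _ D(2)]) auto
  have D_Suc: "D (Suc n) \<subseteq> D n" for n
    unfolding D_def
  proof (intro saturation_mono ideal_sum_PIdl_subset[OF Y(1)] Y(2))
    interpret Yn: ideal "?Y n" R by (rule Y)
    show "y [^] Suc n \<in> ?Y n" using Yn.I_r_closed[OF Y(3) yc] by simp
  qed
  note Dx = ideal_sum_PIdl[OF D(1) xc]
  have DE: "D n <+>\<^bsub>R\<^esub> PIdl x \<subseteq> E n" for n
    unfolding E_def by (rule subset_saturation[OF P2 Dx(1)])
  have E: "ideal (E n) R" "?K \<subseteq> E n" "saturation P2 (E n) = E n" "E (Suc n) \<subseteq> E n" for n
  proof -
    show "ideal (E n) R" unfolding E_def by (rule saturation_ideal[OF P2 Dx(1)])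
    show "saturation P2 (E n) = E n" unfolding E_def by (rule saturation_idem[OF P2 Dx(1)])
    have "?K \<subseteq> D n <+>\<^bsub>R\<^esub> PIdl x"
      using Y(2)[of n] YD[of n] Dx(2)[of n] Dx(3)[of n] by (intro ideal_sum_PIdl_subset[OF Dx(1)]) blast+
    with DE show "?K \<subseteq> E n" by blast
    show "E (Suc n) \<subseteq> E n"
      unfolding E_def using D_Suc[of n] Dx(2)[of n] Dx(3)[of n]
      by (intro saturation_mono ideal_sum_PIdl_subset[OF Dx(1)]) blast+
  qed
  from saturated_dccD[of _ _ E, OF dcc E] obtain N where N: "\<forall>n\<ge>N. E n = E N" by (rule exE)
  have "D N = D (Suc N)"
  proof (rule saturated_nakayama[OF P2 x(1) D(1) D2 D(1) D2 D_Suc])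
    fix r assume r: "r \<in> D N"
    then have "r \<in> E (Suc N)" using N[rule_format, of "Suc N"] DE[of N] Dx(2)[of N] by auto
    then obtain s l t where s: "s \<in> carrier R - P2" and l: "l \<in> D (Suc N)" and t: "t \<in> carrier R"
      and eq: "s \<otimes> r = l \<oplus> t \<otimes> x"
      by (auto simp: E_def saturation_def mem_ideal_sum_PIdl_iff)
    interpret DN: ideal "D N" R by (rule D)
    have lN: "l \<in> D N" using l D_Suc by blast
    have lc: "l \<in> carrier R" using lN by simp
    \<comment> \<open>As \<open>x \<notin> P1\<close>, it is a denominator for the
      \<open>P1\<close>-saturated ideal \<open>D N\<close>. This moves the coefficient
      \<open>t\<close> into \<open>D N\<close>, as Nakayama's lemma demands.\<close>
    have "x \<otimes> t = s \<otimes> r \<ominus> l" unfolding eq using lc t xc by algebra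
    also have "\<dots> \<in> D N" using s r lN DN.I_l_closed unfolding a_minus_def by auto
    finally have "t \<in> saturation P1 (D N)" using t xc x(2) by (intro mem_saturationI[of _ x]) auto
    then have "t \<in> D N" using D(2) by simp
    with s l eq show "\<exists>s\<in>carrier R - P2. \<exists>l\<in>D (Suc N). \<exists>t\<in>D N. s \<otimes> r = l \<oplus> t \<otimes> x" by blast
  qed
  moreover have "y [^] N \<in> D N" using YD[of N] Y(3)[of N] by blast
  ultimately obtain s q c where s: "s \<in> carrier R" "s \<notin> P1" and q: "q \<in> P0" and c: "c \<in> carrier R"
    and eq: "s \<otimes> y [^] N = q \<oplus> c \<otimes> y [^] Suc N"
    by (auto simp: D_def saturation_def mem_ideal_sum_PIdl_iff)
  have qc: "q \<in> carrier R" using q by simp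
  \<comment> \<open>Because \<open>y \<in> P1\<close>, the first factor lies outside
    \<open>P1\<close>, hence outside \<open>P0\<close>, and only the power of \<open>y\<close> can
    belong to \<open>P0\<close>.\<close>
  have "(s \<ominus> c \<otimes> y) \<otimes> y [^] N = s \<otimes> y [^] N \<ominus> c \<otimes> y [^] Suc N"
    using s c yc nat_pow_closed[OF yc, of N] by (simp, algebra)
  also have "\<dots> = q" unfolding eq using qc c nat_pow_closed[OF yc, of "Suc N"] by algebra
  finally have "(s \<ominus> c \<otimes> y) \<otimes> y [^] N \<in> P0" using q by simp
  moreover have "s \<ominus> c \<otimes> y \<notin> P1"
    using s c y P1.I_l_closed by (intro prime_not_mem_minus[OF P1]) auto
  ultimately have "y [^] N \<in> P0"
    using P0.I_prime[of "s \<ominus> c \<otimes> y" "y [^] N"] P01 s c yc by auto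
  then show False using prime_mem_of_pow_mem[OF P0 yc] y(2) by blast
qed


section \<open>Dimension of a quotient by one element\<close>

definition prime_chain :: "('a, 'm) ring_scheme \<Rightarrow> (nat \<Rightarrow> 'a set) \<Rightarrow> nat \<Rightarrow> bool" where
  "prime_chain A P n \<longleftrightarrow> (\<forall>i\<le>n. primeideal (P i) A) \<and> (\<forall>i<n. P i \<subset> P (Suc i))"

lemma krull_dim_eq_Sup_prime_chain: "krull_dim A = Sup {enat n | n. \<exists>P. prime_chain A P n}"
  by (simp add: krull_dim_def prime_chain_def)

lemma prime_chain_update:
  assumes "prime_chain A P n" "primeideal Q A" "P n \<subset> Q"
  shows "prime_chain A (P(Suc n := Q)) (Suc n)"
  using assms by (auto simp: prime_chain_def le_Suc_eq less_Suc_eq)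

lemma prime_chain_mono:
  "prime_chain A P n \<Longrightarrow> m \<le> n \<Longrightarrow> prime_chain A P m"
  by (auto simp: prime_chain_def)

text \<open>Krull's theorem trades the next-to-last prime for one containing \<open>x\<close>,
  keeping the length and the top. Repeating this downwards reaches every member except the bottom
  one, which has no predecessor to start from.\<close>

lemma (in noetherian_cring) prime_chain_through_element:
  assumes "prime_chain R P (Suc n)" "x \<in> P (Suc n)"
  shows "\<exists>Q. prime_chain R Q (Suc n) \<and> x \<in> Q (Suc 0) \<and> Q (Suc n) = P (Suc n)"
  using assms
proof (induction n arbitrary: P)
  case 0
  then show ?case by blast
next
  case (Suc n)
  let ?T = "P (Suc (Suc n))"
  have P: "primeideal (P n) R" "primeideal (P (Suc n)) R" "primeideal ?T R"
    "P n \<subset> P (Suc n)" "P (Suc n) \<subset> ?T"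
    using Suc.prems(1) by (auto simp: prime_chain_def)
  have "\<exists>P'. prime_chain R P' (Suc n) \<and> x \<in> P' (Suc n) \<and> P' (Suc n) \<subset> ?T"
  proof (cases "x \<in> P (Suc n)")
    case True
    then show ?thesis using prime_chain_mono[OF Suc.prems(1), of "Suc n"] P(5) by auto
  next
    case False
    obtain Q where "primeideal Q R" "P n \<subset> Q" "Q \<subset> ?T" "x \<in> Q"
      using krull_principal_ideal_theorem[OF P Suc.prems(2) False] by blast
    then show ?thesis
      using prime_chain_update[OF prime_chain_mono[OF Suc.prems(1), of n], of Q]
      by (intro exI[of _ "P(Suc n := Q)"]) auto
  qed
  then obtain P' where P': "prime_chain R P' (Suc n)" "x \<in> P' (Suc n)" "P' (Suc n) \<subset> ?T" by blast
  obtain Q where Q: "prime_chain R Q (Suc n)" "x \<in> Q (Suc 0)" "Q (Suc n) = P' (Suc n)"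
    using Suc.IH[OF P'(1,2)] by blast
  define Q' where "Q' = Q(Suc (Suc n) := ?T)"
  have "prime_chain R Q' (Suc (Suc n))"
    unfolding Q'_def using P'(3) Q(3) by (intro prime_chain_update[OF Q(1) P(3)]) simp
  moreover have "x \<in> Q' (Suc 0)" "Q' (Suc (Suc n)) = ?T" using Q(2) by (simp_all add: Q'_def)
  ultimately show ?case by blast
qed

section \<open>Primes and dimension of the quotient\<close>

lemma (in ring) rcos_mem_image_iff:
  assumes "ideal I R" "ideal J R" "I \<subseteq> J" "a \<in> carrier R"
  shows "I +> a \<in> (+>) I ` J \<longleftrightarrow> a \<in> J"
proof -
  have "\<Union> ((+>) I ` J) = J" using ideal_incl_iff[OF assms(1,2)] assms(3) by auto
  moreover have "(+>) I ` J \<subseteq> carrier (R Quot I)"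
    using ring_ideal_imp_quot_ideal[OF assms(1,2)] by (meson additive_subgroup.a_subset ideal.axioms(1))
  ultimately show ?thesis using canonical_proj_vimage_mem_iff[OF assms(1) _ assms(4)] by metis
qed

lemma (in ring) carrier_quot: "carrier (R Quot I) = (+>) I ` carrier R"
  by (auto simp: FactRing_def A_RCOSETS_def')

lemma (in cring) primeideal_quot:
  assumes I: "ideal I R" and P: "primeideal P R" and "I \<subseteq> P"
  shows "primeideal ((+>) I ` P) (R Quot I)"
proof (rule primeidealI)
  interpret I: ideal I R by fact
  interpret P: primeideal P R by fact
  note iff = rcos_mem_image_iff[OF I P.is_ideal \<open>I \<subseteq> P\<close>]
  show "ideal ((+>) I ` P) (R Quot I)" by (rule ring_ideal_imp_quot_ideal[OF I P.is_ideal])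
  show "cring (R Quot I)" by (rule I.quotient_is_cring[OF is_cring])
  have "I +> \<one> \<notin> (+>) I ` P" using iff[of \<one>] P.I_notcarr P.one_imp_carrier by blast
  moreover have "I +> \<one> \<in> carrier (R Quot I)" by (simp add: carrier_quot)
  ultimately show "carrier (R Quot I) \<noteq> (+>) I ` P" by blast
  fix u v assume "u \<in> carrier (R Quot I)" "v \<in> carrier (R Quot I)"
    and uv: "u \<otimes>\<^bsub>R Quot I\<^esub> v \<in> (+>) I ` P"
  then obtain a b where ab: "a \<in> carrier R" "b \<in> carrier R" "u = I +> a" "v = I +> b"
    by (auto simp: carrier_quot)
  have "I +> (a \<otimes> b) = u \<otimes>\<^bsub>R Quot I\<^esub> v"
    using ring_hom_mult[OF I.rcos_ring_hom] ab by simp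
  with uv have "a \<otimes> b \<in> P" using iff[of "a \<otimes> b"] ab by simp
  then show "u \<in> (+>) I ` P \<or> v \<in> (+>) I ` P" using P.I_prime ab by blast
qed

text \<open>The summand 1 pays for the bottom member of the chain, the only one that may miss
  \<open>x\<close>. The assumption \<open>through\<close> isolates the point at which the local and
  the graded case differ.\<close>

lemma (in noetherian_cring) krull_dim_le_quot:
  assumes x: "x \<in> carrier R"
    and through: "\<And>P n. prime_chain R P (Suc n) \<Longrightarrow> \<exists>Q. prime_chain R Q (Suc n) \<and> x \<in> Q (Suc n)"
  shows "krull_dim R \<le> krull_dim (R Quot PIdl x) + 1"
  unfolding krull_dim_eq_Sup_prime_chain[of R]
proof (rule Sup_least)
  fix d assume "d \<in> {enat n | n. \<exists>P. prime_chain R P n}"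
  then obtain n P where d: "d = enat n" and P: "prime_chain R P n" by blast
  show "d \<le> krull_dim (R Quot PIdl x) + 1"
  proof (cases n)
    case 0
    then show ?thesis by (simp add: d zero_enat_def[symmetric])
  next
    case (Suc m)
    obtain P' where "prime_chain R P' (Suc m)" "x \<in> P' (Suc m)" using through P Suc by blast
    then obtain Q where Q: "prime_chain R Q (Suc m)" "x \<in> Q (Suc 0)"
      using prime_chain_through_element by blast
    let ?I = "PIdl x"
    have I: "ideal ?I R" by (rule cgenideal_ideal[OF x])
    have prime: "primeideal (Q (Suc i)) R" if "i \<le> m" for i using Q(1) that by (simp add: prime_chain_def)
    have idl: "ideal (Q (Suc i)) R" if "i \<le> m" for i using prime[OF that] by (simp add: primeideal_def)
    have xQ: "x \<in> Q (Suc i)" if "i \<le> m" for i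
      using that
    proof (induction i)
      case (Suc i)
      then have "Q (Suc i) \<subset> Q (Suc (Suc i))" using Q(1) by (simp add: prime_chain_def)
      with Suc show ?case by auto
    qed (use Q in simp)
    have IQ: "?I \<subseteq> Q (Suc i)" if "i \<le> m" for i
      by (rule cgenideal_minimal[OF idl[OF that] xQ[OF that]])
    have "prime_chain (R Quot ?I) (\<lambda>i. (+>) ?I ` Q (Suc i)) m"
      unfolding prime_chain_def
    proof (intro conjI allI impI)
      fix i assume "i \<le> m"
      then show "primeideal ((+>) ?I ` Q (Suc i)) (R Quot ?I)" using primeideal_quot[OF I prime IQ] by blast
    next
      fix i assume i: "i < m"
      have "Q (Suc i) \<subset> Q (Suc (Suc i))" using Q(1) i by (simp add: prime_chain_def)
      then obtain a where a: "a \<in> Q (Suc (Suc i))" "a \<notin> Q (Suc i)" and sub: "Q (Suc i) \<subseteq> Q (Suc (Suc i))" by blast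
      have "a \<in> carrier R" using a idl[of "Suc i"] i by (simp add: ideal.Icarr)
      then have "?I +> a \<notin> (+>) ?I ` Q (Suc i)"
        using rcos_mem_image_iff[OF I idl IQ, of i] a i by simp
      with a sub show "(+>) ?I ` Q (Suc i) \<subset> (+>) ?I ` Q (Suc (Suc i))" by blast
    qed
    then have "enat m \<le> krull_dim (R Quot ?I)"
      unfolding krull_dim_eq_Sup_prime_chain by (intro Sup_upper) blast
    then have "enat m + 1 \<le> krull_dim (R Quot ?I) + 1" by (rule add_right_mono)
    then show ?thesis by (simp add: d Suc one_enat_def)
  qed
qed

section \<open>Surjective ring homomorphisms\<close>

context ring_hom_ring
begin

lemma ideal_image_surj:
  assumes surj: "h ` carrier R = carrier S" and J: "ideal J R"
  shows "ideal (h ` J) S"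
proof (rule idealI)
  interpret J: ideal J R by fact
  show "ring S" ..
  show "subgroup (h ` J) (add_monoid S)" by (rule img_is_add_subgroup[OF J.a_subgroup])
  fix a y assume "a \<in> h ` J" "y \<in> carrier S"
  then obtain j r where j: "j \<in> J" "a = h j" and r: "r \<in> carrier R" "y = h r" using surj by blast
  have "y \<otimes>\<^bsub>S\<^esub> a = h (r \<otimes> j)" "a \<otimes>\<^bsub>S\<^esub> y = h (j \<otimes> r)" using j r by auto
  then show "y \<otimes>\<^bsub>S\<^esub> a \<in> h ` J" "a \<otimes>\<^bsub>S\<^esub> y \<in> h ` J"
    using J.I_l_closed[OF j(1) r(1)] J.I_r_closed[OF j(1) r(1)] by blast+
qed

lemma genideal_image:
  assumes surj: "h ` carrier R = carrier S" and F: "F \<subseteq> carrier R"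
  shows "Idl\<^bsub>S\<^esub> (h ` F) = h ` (Idl\<^bsub>R\<^esub> F)"
proof
  have hF: "h ` F \<subseteq> carrier S" using F by auto
  show "Idl\<^bsub>S\<^esub> (h ` F) \<subseteq> h ` (Idl\<^bsub>R\<^esub> F)"
    using R.genideal_self[OF F]
    by (intro S.genideal_minimal ideal_image_surj[OF surj] R.genideal_ideal[OF F]) blast
  have "F \<subseteq> {r \<in> carrier R. h r \<in> Idl\<^bsub>S\<^esub> (h ` F)}"
    using F S.genideal_self[OF hF] by blast
  then have "Idl\<^bsub>R\<^esub> F \<subseteq> {r \<in> carrier R. h r \<in> Idl\<^bsub>S\<^esub> (h ` F)}"
    by (intro R.genideal_minimal ideal_vimage S.genideal_ideal[OF hF])
  then show "h ` (Idl\<^bsub>R\<^esub> F) \<subseteq> Idl\<^bsub>S\<^esub> (h ` F)" by blast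
qed

lemma maximalideal_vimage:
  assumes surj: "h ` carrier R = carrier S" and N: "maximalideal N S"
  shows "maximalideal {r \<in> carrier R. h r \<in> N} R"
proof (rule maximalidealI)
  interpret N: maximalideal N S by fact
  let ?M = "{r \<in> carrier R. h r \<in> N}"
  show "ideal ?M R" by (rule ideal_vimage[OF N.is_ideal])
  have "\<one>\<^bsub>S\<^esub> \<notin> N" using N.I_notcarr N.one_imp_carrier by blast
  then have "\<one> \<notin> ?M" by simp
  then show "carrier R \<noteq> ?M" using R.one_closed by blast
  fix J assume J: "ideal J R" "?M \<subseteq> J" "J \<subseteq> carrier R"
  interpret J: ideal J R by (rule J)
  show "J = ?M \<or> J = carrier R"
  proof (cases "J \<subseteq> ?M")
    case False
    then obtain a where a: "a \<in> J" "h a \<notin> N" using J(3) by blast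
    have "N \<subseteq> h ` J"
    proof
      fix y assume y: "y \<in> N"
      then have "y \<in> h ` carrier R" using surj N.Icarr by simp
      then show "y \<in> h ` J" using y J(2) by blast
    qed
    moreover have "h ` J \<subseteq> carrier S" using J(3) by auto
    ultimately have "h ` J = N \<or> h ` J = carrier S"
      by (rule N.I_maximal[OF ideal_image_surj[OF surj J(1)]])
    then have hJ: "h ` J = carrier S" using a by blast
    have "r \<in> J" if r: "r \<in> carrier R" for r
    proof -
      have "h r \<in> h ` J" using hJ r by simp
      then obtain j where j: "j \<in> J" "h r = h j" by blast
      have jc: "j \<in> carrier R" using j by simp
      \<comment> \<open>\<open>J\<close> contains the kernel of \<open>h\<close>, because
        \<open>?M\<close> does; so it contains every element with the same image as one of its
        members.\<close>
      have "h (r \<ominus> j) = \<zero>\<^bsub>S\<^esub>" using r jc j(2) by (simp add: R.minus_eq S.r_neg)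
      then have "r \<ominus> j \<in> J" using J(2) r jc N.zero_closed by auto
      then have "(r \<ominus> j) \<oplus> j \<in> J" using j(1) by (rule J.a_closed)
      moreover have "(r \<ominus> j) \<oplus> j = r" using r jc by algebra
      ultimately show "r \<in> J" by simp
    qed
    then show ?thesis using J(3) by blast
  qed (use J in blast)
qed

end

section \<open>Maximal ideals of local rings\<close>

lemma maximalideal_the_max_ideal:
  "local_ring A \<Longrightarrow> maximalideal (the_max_ideal A) A"
  unfolding local_ring_def the_max_ideal_def by (elim conjE) (rule theI')

lemma the_max_ideal_unique:
  "local_ring A \<Longrightarrow> maximalideal I A \<Longrightarrow> I = the_max_ideal A"
  using maximalideal_the_max_ideal unfolding local_ring_def by blast

text \<open>The preimage of the maximal ideal of \<open>S\<close> is maximal, hence is the one of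
  \<open>R\<close>; surjectivity recovers an ideal from its preimage.\<close>

lemma (in ring_hom_ring) the_max_ideal_image:
  assumes surj: "h ` carrier R = carrier S" and "local_ring R" "local_ring S"
  shows "h ` the_max_ideal R = the_max_ideal S"
proof -
  let ?N = "the_max_ideal S"
  have N: "maximalideal ?N S" by (rule maximalideal_the_max_ideal) fact
  have "{r \<in> carrier R. h r \<in> ?N} = the_max_ideal R"
    by (rule the_max_ideal_unique[OF assms(2) maximalideal_vimage[OF surj N]])
  moreover have "h ` {r \<in> carrier R. h r \<in> ?N} = ?N \<inter> h ` carrier R" by auto
  moreover have "?N \<subseteq> carrier S"
    using N by (simp add: maximalideal_def ideal_def additive_subgroup.a_subset)
  ultimately show ?thesis using surj by (simp add: Int_absorb2)
qed


section \<open>Local cohomology along a ring homomorphism\<close>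

text \<open>Unlike \<open>finprod_cong\<close>, this needs neither a monoid nor closedness.\<close>

lemma finprod_cong_on:
  fixes f :: "'i \<Rightarrow> 'g"
  assumes "\<And>i. i \<in> A \<Longrightarrow> f i = g i"
  shows "finprod G f A = finprod G g A"
proof -
  have *: "(A, x) \<in> foldSetD D \<phi>' e"
    if "(A, x) \<in> foldSetD D \<phi> e" and "\<forall>i\<in>A. \<phi> i = \<phi>' i" for D e x and \<phi> \<phi>' :: "'i \<Rightarrow> 'g \<Rightarrow> 'g"
    using that
  proof (induction rule: foldSetD.induct)
    case (insertI i A y)
    then have "(insert i A, \<phi>' i y) \<in> foldSetD D \<phi>' e" by (intro foldSetD.insertI) auto
    with insertI.prems show ?case by simp
  qed (rule foldSetD.emptyI)
  let ?f = "monoid.mult G \<circ> f" and ?g = "monoid.mult G \<circ> g"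
  have "\<forall>i\<in>A. ?f i = ?g i" "\<forall>i\<in>A. ?g i = ?f i" using assms by simp_all
  then have "(A, x) \<in> foldSetD D ?f e \<longleftrightarrow> (A, x) \<in> foldSetD D ?g e" for D e x
    using *[of x D ?f e ?g] *[of x D ?g e ?f] by blast
  then show ?thesis by (simp add: finprod_def foldD_def)
qed

lemma product_group_cong:
  assumes "\<And>i. i \<in> I \<Longrightarrow> G i = H i"
  shows "product_group I G = product_group I H"
  unfolding product_group_def using assms by (auto intro!: PiE_cong restrict_ext ext)

text \<open>The Cech complex of an \<open>R\<close>-algebra \<open>A\<close> only involves the images in \<open>A\<close> of the sequence, so the
  complexes over \<open>R\<close> and over \<open>A\<close> are equal on the nose, not merely isomorphic.\<close>

context ring_hom_cring
begin

lemma hom_pow: "f \<in> carrier R \<Longrightarrow> h (f [^] (n::nat)) = h f [^]\<^bsub>S\<^esub> n"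
  by (induction n) auto

lemma frac_rel_via:
  "f \<in> carrier R \<Longrightarrow> frac_rel R (algebra_via h S) f = frac_rel S (algebra_via id S) (h f)"
  by (simp add: frac_rel_def algebra_via_def hom_pow)

lemma loc_frac_via:
  "f \<in> carrier R \<Longrightarrow> loc_frac R (algebra_via h S) f = loc_frac S (algebra_via id S) (h f)"
  by (simp add: fun_eq_iff loc_frac_def frac_rel_via)

lemma loc_group_via:
  "f \<in> carrier R \<Longrightarrow> loc_group R (algebra_via h S) f = loc_group S (algebra_via id S) (h f)"
  unfolding loc_group_def by (simp add: loc_frac_via frac_rel_via) (simp add: algebra_via_def hom_pow)

lemma loc_map_via:
  "g \<in> carrier R \<Longrightarrow> f \<in> carrier R \<Longrightarrow>
    loc_map R (algebra_via h S) g f = loc_map S (algebra_via id S) (h g) (h f)"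
  unfolding loc_map_def fun_eq_iff by (simp add: loc_frac_via) (simp add: algebra_via_def hom_pow)

lemma loc_frob_via:
  "f \<in> carrier R \<Longrightarrow> loc_frob R (algebra_via h S) p f = loc_frob S (algebra_via id S) p (h f)"
  unfolding loc_frob_def fun_eq_iff by (simp add: loc_frac_via) (simp add: algebra_via_def nat_pow_def)

context
  fixes fs :: "'a list"
  assumes fs: "set fs \<subseteq> carrier R"
begin

lemma nth_cech_index:
  assumes "I \<in> cech_index fs j" "i \<in> I"
  shows "i < length fs" "fs ! i \<in> carrier R"
proof -
  show "i < length fs" using assms by (auto simp: cech_index_def)
  then show "fs ! i \<in> carrier R" using fs nth_mem by blast
qed

lemma prod_at_closed: "I \<in> cech_index fs j \<Longrightarrow> prod_at R fs I \<in> carrier R"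
  unfolding prod_at_def using nth_cech_index(2) by (intro R.finprod_closed) auto

lemma prod_at_via:
  assumes I: "I \<in> cech_index fs j"
  shows "h (prod_at R fs I) = prod_at S (map h fs) I"
proof -
  have "h (prod_at R fs I) = (\<Otimes>\<^bsub>S\<^esub>i\<in>I. (h \<circ> (!) fs) i)"
    unfolding prod_at_def using nth_cech_index(2)[OF I] by (intro hom_finprod) auto
  also have "\<dots> = prod_at S (map h fs) I"
    unfolding prod_at_def using nth_cech_index(1)[OF I] by (intro finprod_cong_on) simp
  finally show ?thesis .
qed

text \<open>The complex is indexed by positions and not by values, so nothing is lost when
  \<open>h\<close> identifies entries of \<open>fs\<close>.\<close>

lemma cech_index_map: "cech_index (map h fs) = cech_index fs"
  by (simp add: fun_eq_iff cech_index_def)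

lemma cech_group_via:
  "cech_group R (algebra_via h S) fs j = cech_group S (algebra_via id S) (map h fs) j"
  unfolding cech_group_def cech_index_map
  by (intro product_group_cong) (simp add: loc_group_via prod_at_closed prod_at_via)

lemma cech_diff_via:
  "cech_diff R (algebra_via h S) fs j = cech_diff S (algebra_via id S) (map h fs) j"
  unfolding cech_diff_def cech_index_map
proof (rule ext, rule restrict_ext)
  fix c J assume J: "J \<in> cech_index fs (Suc j)"
  have i: "fs ! i \<in> carrier R" "map h fs ! i = h (fs ! i)" if "i \<in> J" for i
    using nth_cech_index[OF J that] by simp_all
  show "(\<Otimes>\<^bsub>loc_group R (algebra_via h S) (prod_at R fs J)\<^esub>i\<in>J.
          let y = loc_map R (algebra_via h S) (fs ! i) (prod_at R fs J) (c (J - {i}))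
          in if even (card {l \<in> J. l < i}) then y
             else inv\<^bsub>loc_group R (algebra_via h S) (prod_at R fs J)\<^esub> y) =
        (\<Otimes>\<^bsub>loc_group S (algebra_via id S) (prod_at S (map h fs) J)\<^esub>i\<in>J.
          let y = loc_map S (algebra_via id S) (map h fs ! i) (prod_at S (map h fs) J) (c (J - {i}))
          in if even (card {l \<in> J. l < i}) then y
             else inv\<^bsub>loc_group S (algebra_via id S) (prod_at S (map h fs) J)\<^esub> y)"
    unfolding loc_group_via[OF prod_at_closed[OF J]] prod_at_via[OF J]
    by (intro finprod_cong_on) (simp only: i loc_map_via[OF i(1) prod_at_closed[OF J]] prod_at_via[OF J])
qed

lemma cech_frob_via:
  "cech_frob R (algebra_via h S) p fs j = cech_frob S (algebra_via id S) p (map h fs) j"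
  unfolding cech_frob_def cech_index_map
  by (rule ext, rule restrict_ext) (simp add: loc_frob_via prod_at_closed prod_at_via)

lemma cocycles_via:
  "cocycles R (algebra_via h S) fs j = cocycles S (algebra_via id S) (map h fs) j"
  unfolding cocycles_def cech_group_via cech_diff_via ..

lemma coboundaries_via:
  "coboundaries R (algebra_via h S) fs j = coboundaries S (algebra_via id S) (map h fs) j"
  unfolding coboundaries_def cech_group_via cech_diff_via ..

lemma local_cohomology_via:
  "local_cohomology R (algebra_via h S) fs j = local_cohomology S (algebra_via id S) (map h fs) j"
  unfolding local_cohomology_def cocycles_via coboundaries_via ..

lemma frob_action_via:
  "frob_action R (algebra_via h S) p fs j = frob_action S (algebra_via id S) p (map h fs) j"
  unfolding frob_action_def cocycles_via coboundaries_via cech_frob_via ..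

end

lemma lc_nilpotent_via:
  assumes surj: "h ` carrier R = carrier S"
    and nilp: "lc_nilpotent S (h ` \<mm>) (algebra_via id S) p j"
  shows "lc_nilpotent R \<mm> (algebra_via h S) p j"
  unfolding lc_nilpotent_def
proof (intro allI impI, elim conjE)
  fix fs assume fs: "set fs \<subseteq> carrier R" and "Idl\<^bsub>R\<^esub> (set fs) = \<mm>"
  have "set (map h fs) \<subseteq> carrier S" "Idl\<^bsub>S\<^esub> (set (map h fs)) = h ` \<mm>"
    using fs ring.genideal_image[OF surj fs] \<open>Idl\<^bsub>R\<^esub> (set fs) = \<mm>\<close> by auto
  then show "\<forall>\<xi>\<in>carrier (local_cohomology R (algebra_via h S) fs j).
      \<exists>e. (frob_action R (algebra_via h S) p fs j ^^ e) \<xi> = \<one>\<^bsub>local_cohomology R (algebra_via h S) fs j\<^esub>"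
    using nilp unfolding local_cohomology_via[OF fs] frob_action_via[OF fs] lc_nilpotent_def by blast
qed

end

section \<open>F-depth compared with dimension\<close>

lemma lc_nilpotent_below_Fdepth:
  assumes "enat j < Fdepth R \<mm> M p"
  shows "lc_nilpotent R \<mm> M p j"
proof (rule ccontr)
  assume "\<not> lc_nilpotent R \<mm> M p j"
  then have "Fdepth R \<mm> M p \<le> enat j" unfolding Fdepth_def by (intro Inf_lower) blast
  with assms show False by simp
qed

lemma le_FdepthI:
  assumes "\<And>j. enat j < d \<Longrightarrow> lc_nilpotent R \<mm> M p j"
  shows "d \<le> Fdepth R \<mm> M p"
  unfolding Fdepth_def using assms by (intro Inf_greatest) (auto simp: not_less[symmetric])

text \<open>The common core of both cases, which supply their own \<open>\<mm>\<close> and their own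
  proof of \<open>through\<close>.\<close>

lemma (in noetherian_cring) lc_nilpotent_below_dim:
  fixes x
  defines "A \<equiv> R Quot PIdl x"
  assumes x: "F_depth_element R \<mm> p x"
    and \<mm>: "(+>) (PIdl x) ` \<mm> = \<mm>'"
    and through: "\<And>P n. prime_chain R P (Suc n) \<Longrightarrow> \<exists>Q. prime_chain R Q (Suc n) \<and> x \<in> Q (Suc n)"
    and nilp: "\<And>j. enat j < krull_dim A \<Longrightarrow> lc_nilpotent A \<mm>' (algebra_via id A) p j"
    and j: "enat j < krull_dim R"
  shows "lc_nilpotent R \<mm> (algebra_via id R) p j"
proof (rule lc_nilpotent_below_Fdepth)
  have xc: "x \<in> carrier R" using x by (simp add: F_depth_element_def regular_element_def)
  interpret I: ideal "PIdl x" R by (rule cgenideal_ideal[OF xc])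
  interpret h: ring_hom_cring R A "(+>) (PIdl x)"
    unfolding A_def by (rule I.rcos_ring_hom_cring[OF is_cring])
  let ?F = "Fdepth R \<mm> (algebra_via ((+>) (PIdl x)) A) p"
  \<comment> \<open>\<open>F_depth_element\<close> refers to the quotient as an algebra over
    \<open>R\<close>, \<open>nilp\<close> to the quotient over itself; the change of rings bridges
    the two.\<close>
  have "lc_nilpotent R \<mm> (algebra_via ((+>) (PIdl x)) A) p j" if "enat j < krull_dim A" for j
    by (rule h.lc_nilpotent_via) (use nilp[OF that] \<mm> in \<open>simp_all add: A_def carrier_quot\<close>)
  then have "krull_dim A \<le> ?F" by (rule le_FdepthI)
  have "krull_dim R \<le> krull_dim A + 1"
    unfolding A_def by (rule krull_dim_le_quot[OF xc]) (rule through)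
  with j have "enat j < krull_dim A + 1" by (rule less_le_trans)
  also have "\<dots> \<le> ?F + 1" using \<open>krull_dim A \<le> ?F\<close> by (rule add_right_mono)
  also have "\<dots> = Fdepth R \<mm> (algebra_via id R) p" using x by (simp add: F_depth_element_def A_def)
  finally show "enat j < Fdepth R \<mm> (algebra_via id R) p" .
qed

section \<open>The local case\<close>

lemma (in ring) ideal_proper_of_quot_nontrivial:
  assumes I: "ideal I R" and "\<one>\<^bsub>R Quot I\<^esub> \<noteq> \<zero>\<^bsub>R Quot I\<^esub>"
  shows "I \<noteq> carrier R"
  using assms(2) a_rcos_zero[OF I, of \<one>] by (auto simp: FactRing_def)

lemma (in ring) proper_ideal_le_the_max_ideal:
  assumes loc: "local_ring R" and I: "ideal I R" "I \<noteq> carrier R"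
  shows "I \<subseteq> the_max_ideal R"
proof -
  obtain M where "maximalideal M R" "I \<subseteq> M" by (rule proper_ideal_in_maximalideal[OF I])
  then show ?thesis using the_max_ideal_unique[OF loc] by simp
qed

theorem weakly_F_nilpotent_local_of_quotient:
  fixes R (structure)
  assumes R: "noetherian_local_ring R p" and x: "F_depth_element R (the_max_ideal R) p x"
    and A: "weakly_F_nilpotent_local (R Quot PIdl\<^bsub>R\<^esub> x) p"
  shows "weakly_F_nilpotent_local R p"
  unfolding weakly_F_nilpotent_local_def
proof (intro conjI allI impI R)
  interpret noetherian_cring R
    using R by (simp add: noetherian_cring_def noetherian_local_ring_def local_ring_def)
  let ?I = "PIdl\<^bsub>R\<^esub> x" and ?m = "the_max_ideal R"
  have loc: "local_ring R" using R by (simp add: noetherian_local_ring_def)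
  have locA: "local_ring (R Quot ?I)" and nt: "\<one>\<^bsub>R Quot ?I\<^esub> \<noteq> \<zero>\<^bsub>R Quot ?I\<^esub>"
    using A by (simp_all add: weakly_F_nilpotent_local_def noetherian_local_ring_def has_prime_char_def)
  have xc: "x \<in> carrier R" using x by (simp add: F_depth_element_def regular_element_def)
  interpret I: ideal ?I R by (rule cgenideal_ideal[OF xc])
  \<comment> \<open>The characteristic of the quotient includes
    \<open>\<one> \<noteq> \<zero>\<close>, so \<open>x\<close> is not a unit.\<close>
  have xm: "x \<in> ?m"
    using proper_ideal_le_the_max_ideal[OF loc I.is_ideal ideal_proper_of_quot_nontrivial[OF I.is_ideal nt]]
      cgenideal_self[OF xc] by (rule subsetD)
  have m: "maximalideal ?m R" by (rule maximalideal_the_max_ideal[OF loc])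
  have hm: "(+>) ?I ` ?m = the_max_ideal (R Quot ?I)"
    using loc locA by (intro ring_hom_ring.the_max_ideal_image[OF I.rcos_ring_hom_ring]) (simp add: carrier_quot)
  fix j assume j: "enat j < krull_dim R"
  show "lc_nilpotent R ?m (algebra_via id R) p j"
  proof (rule lc_nilpotent_below_dim[OF x hm _ _ j])
    show "lc_nilpotent (R Quot ?I) (the_max_ideal (R Quot ?I)) (algebra_via id (R Quot ?I)) p j"
      if "enat j < krull_dim (R Quot ?I)" for j
      using A that by (simp add: weakly_F_nilpotent_local_def)
    fix P n assume P: "prime_chain R P (Suc n)"
    interpret Pn: primeideal "P (Suc n)" R using P by (simp add: prime_chain_def)
    have "P (Suc n) \<subseteq> ?m"
      by (rule proper_ideal_le_the_max_ideal[OF loc Pn.is_ideal Pn.I_notcarr[symmetric]])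
    moreover have "P n \<subset> P (Suc n)" using P by (simp add: prime_chain_def)
    \<comment> \<open>Enlarging the top to the maximal ideal keeps the length and brings in
      \<open>x\<close>.\<close>
    ultimately have "prime_chain R (P(Suc n := ?m)) (Suc n)"
      using maximalideal_prime[OF m] by (intro prime_chain_update prime_chain_mono[OF P]) auto
    moreover have "x \<in> (P(Suc n := ?m)) (Suc n)" using xm by simp
    ultimately show "\<exists>Q. prime_chain R Q (Suc n) \<and> x \<in> Q (Suc n)" by blast
  qed
qed

section \<open>Primes in graded rings\<close>

lemma (in cring) ideal_finsum_closed:
  assumes I: "ideal I R" and "\<And>i. i \<in> A \<Longrightarrow> f i \<in> I"
  shows "(\<Oplus>i\<in>A. f i) \<in> I"
proof -
  interpret I: ideal I R by fact
  show ?thesis using assms(2)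
  proof (induction A rule: infinite_finite_induct)
    case (insert i A)
    then have "f \<in> A \<rightarrow> carrier R" "f i \<in> carrier R" by auto
    with insert show ?case by (simp add: I.a_closed)
  qed auto
qed

section \<open>Homogeneous components\<close>

locale nat_graded_ring = cring +
  fixes G :: "nat \<Rightarrow> 'a set"
  assumes graded: "nat_graded R G"
begin

definition component :: "'a \<Rightarrow> nat \<Rightarrow> 'a" where
  "component a = (THE c. (\<forall>n. c n \<in> G n) \<and> finite {n. c n \<noteq> \<zero>} \<and> a = (\<Oplus>n\<in>{n. c n \<noteq> \<zero>}. c n))"

lemma G_subgroup: "subgroup (G n) (add_monoid R)"
  using graded by (simp add: nat_graded_def)

lemma G_carrier: "a \<in> G n \<Longrightarrow> a \<in> carrier R"
  using subgroup.mem_carrier[OF G_subgroup] by simp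

lemma G_zero: "\<zero> \<in> G n"
  using subgroup.one_closed[OF G_subgroup] by simp

lemma G_add: "a \<in> G n \<Longrightarrow> b \<in> G n \<Longrightarrow> a \<oplus> b \<in> G n"
  using subgroup.m_closed[OF G_subgroup] by simp

lemma G_one: "\<one> \<in> G 0"
  using graded by (simp add: nat_graded_def)

lemma G_mult: "a \<in> G i \<Longrightarrow> b \<in> G j \<Longrightarrow> a \<otimes> b \<in> G (i + j)"
  using graded by (simp add: nat_graded_def)

lemma component_ex1:
  "a \<in> carrier R \<Longrightarrow>
    \<exists>!c. (\<forall>n. c n \<in> G n) \<and> finite {n. c n \<noteq> \<zero>} \<and> a = (\<Oplus>n\<in>{n. c n \<noteq> \<zero>}. c n)"
  using graded by (simp add: nat_graded_def)

lemma component_spec: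
  assumes "a \<in> carrier R"
  shows "component a n \<in> G n" "finite {n. component a n \<noteq> \<zero>}"
    "a = (\<Oplus>n\<in>{n. component a n \<noteq> \<zero>}. component a n)"
  using theI'[OF component_ex1[OF assms]] unfolding component_def[symmetric] by blast+

lemma component_closed: "a \<in> carrier R \<Longrightarrow> component a n \<in> carrier R"
  using component_spec(1) G_carrier by blast

lemma finsum_support:
  assumes "finite N" "\<And>n. n \<notin> N \<Longrightarrow> c n = \<zero>" "\<And>n. c n \<in> carrier R"
  shows "(\<Oplus>n\<in>{n. c n \<noteq> \<zero>}. c n) = (\<Oplus>n\<in>N. c n)"
  using assms by (intro add.finprod_mono_neutral_cong_left) auto

lemma component_unique:
  assumes c: "\<And>n. c n \<in> G n" and N: "finite N" "\<And>n. n \<notin> N \<Longrightarrow> c n = \<zero>" and a: "a = (\<Oplus>n\<in>N. c n)"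
  shows "component a = c"
proof -
  have cc: "c n \<in> carrier R" for n using c G_carrier by blast
  have "a \<in> carrier R" unfolding a using cc by (intro finsum_closed) auto
  moreover have "finite {n. c n \<noteq> \<zero>}" using N(2) by (intro finite_subset[OF _ N(1)]) auto
  moreover have "a = (\<Oplus>n\<in>{n. c n \<noteq> \<zero>}. c n)" using finsum_support[OF N cc] a by simp
  ultimately show ?thesis
    unfolding component_def using c by (intro the1_equality component_ex1) simp_all
qed

lemma sum_components:
  assumes "a \<in> carrier R" "finite N" "\<And>n. n \<notin> N \<Longrightarrow> component a n = \<zero>"
  shows "a = (\<Oplus>n\<in>N. component a n)"
  using component_spec(3)[OF assms(1)] finsum_support[OF assms(2,3) component_closed[OF assms(1)]]
  by simp

lemma component_add:
  assumes a: "a \<in> carrier R" and b: "b \<in> carrier R"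
  shows "component (a \<oplus> b) n = component a n \<oplus> component b n"
proof -
  let ?N = "{n. component a n \<noteq> \<zero>} \<union> {n. component b n \<noteq> \<zero>}"
  have N: "finite ?N" using component_spec(2) a b by simp
  have cl: "component a \<in> ?N \<rightarrow> carrier R" "component b \<in> ?N \<rightarrow> carrier R"
    using component_closed a b by auto
  have "a \<oplus> b = (\<Oplus>n\<in>?N. component a n) \<oplus> (\<Oplus>n\<in>?N. component b n)"
    using sum_components[OF a N] sum_components[OF b N] by auto
  also have "\<dots> = (\<Oplus>n\<in>?N. component a n \<oplus> component b n)" by (rule finsum_addf[OF cl, symmetric])
  finally have "component (a \<oplus> b) = (\<lambda>n. component a n \<oplus> component b n)"
    using component_spec(1) G_add a b N by (intro component_unique[of _ ?N]) auto
  then show ?thesis by simp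
qed

lemma component_homog:
  assumes "a \<in> G d"
  shows "component a n = (if n = d then a else \<zero>)"
proof -
  have "component a = (\<lambda>n. if n = d then a else \<zero>)"
    using assms G_zero G_carrier[OF assms] by (intro component_unique[of _ "{d}"]) auto
  then show ?thesis by simp
qed

lemma component_zero [simp]: "component \<zero> n = \<zero>"
  using component_homog[OF G_zero[of 0]] by simp

lemma component_finsum:
  assumes "finite A" "\<And>i. i \<in> A \<Longrightarrow> f i \<in> carrier R"
  shows "component (\<Oplus>i\<in>A. f i) n = (\<Oplus>i\<in>A. component (f i) n)"
  using assms
proof (induction A rule: finite_induct)
  case (insert i A)
  then have "f \<in> A \<rightarrow> carrier R" "(\<lambda>i. component (f i) n) \<in> A \<rightarrow> carrier R"
    using component_closed by auto
  with insert show ?case by (simp add: component_add component_closed finsum_closed)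
qed simp

lemma component_homog_mult:
  assumes g: "g \<in> G d" and a: "a \<in> carrier R"
  shows "component (g \<otimes> a) n = (if d \<le> n then g \<otimes> component a (n - d) else \<zero>)"
proof -
  let ?c = "\<lambda>n. if d \<le> n then g \<otimes> component a (n - d) else \<zero>"
  let ?N = "{n. component a n \<noteq> \<zero>}"
  have gc: "g \<in> carrier R" using g by (rule G_carrier)
  have N: "finite ?N" by (rule component_spec(2)[OF a])
  have "g \<otimes> a = g \<otimes> (\<Oplus>m\<in>?N. component a m)" using component_spec(3)[OF a] by simp
  also have "\<dots> = (\<Oplus>m\<in>?N. g \<otimes> component a m)"
    using component_closed[OF a] by (intro finsum_rdistr[OF N gc]) auto
  also have "\<dots> = (\<Oplus>m\<in>?N. ?c (d + m))" by simp
  also have "\<dots> = (\<Oplus>n\<in>(+) d ` ?N. ?c n)"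
    using gc component_closed[OF a] by (intro finsum_reindex[symmetric]) auto
  finally have eq: "g \<otimes> a = (\<Oplus>n\<in>(+) d ` ?N. ?c n)" .
  have "component (g \<otimes> a) = ?c"
  proof (rule component_unique[OF _ _ _ eq])
    show "?c n \<in> G n" for n using G_mult[OF g component_spec(1)[OF a, of "n - d"]] G_zero by auto
    show "finite ((+) d ` ?N)" using N by simp
    fix n assume n: "n \<notin> (+) d ` ?N"
    have "component a (n - d) = \<zero>" if "d \<le> n"
    proof (rule ccontr)
      assume "component a (n - d) \<noteq> \<zero>"
      then have "d + (n - d) \<in> (+) d ` ?N" by blast
      with n that show False by simp
    qed
    then show "?c n = \<zero>" using gc by simp
  qed
  then show ?thesis by simp
qed

lemma component_uminus:
  assumes "a \<in> carrier R"
  shows "component (\<ominus> a) n = \<ominus> component a n"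
proof -
  have "component (\<ominus> a) n \<oplus> component a n = component (\<ominus> a \<oplus> a) n"
    using assms by (simp add: component_add)
  also have "\<dots> = \<zero>" using assms by (simp add: l_neg)
  finally show ?thesis using assms component_closed by (intro minus_equality[symmetric]) auto
qed

lemma component_minus:
  "a \<in> carrier R \<Longrightarrow> b \<in> carrier R \<Longrightarrow> component (a \<ominus> b) n = component a n \<ominus> component b n"
  by (simp add: minus_eq component_add component_uminus)

lemma component_mult:
  assumes a: "a \<in> carrier R" and b: "b \<in> carrier R"
  shows "component (a \<otimes> b) n = (\<Oplus>i\<in>{..n}. component a i \<otimes> component b (n - i))"
proof -
  \<comment> \<open>Adding \<open>{..n}\<close> to the support puts the whole range of the
    convolution inside the index set; the terms beyond \<open>n\<close> vanish in degree
    \<open>n\<close>.\<close>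
  let ?N = "{n. component a n \<noteq> \<zero>} \<union> {..n}"
  have N: "finite ?N" using component_spec(2)[OF a] by simp
  have cl: "component a i \<in> carrier R" "component b i \<in> carrier R" for i
    using component_closed a b by auto
  have "a \<otimes> b = (\<Oplus>i\<in>?N. component a i) \<otimes> b" using sum_components[OF a N] by auto
  also have "\<dots> = (\<Oplus>i\<in>?N. component a i \<otimes> b)" using cl by (intro finsum_ldistr[OF N b]) auto
  finally have "component (a \<otimes> b) n = (\<Oplus>i\<in>?N. component (component a i \<otimes> b) n)"
    using component_finsum[OF N, of "\<lambda>i. component a i \<otimes> b"] cl b by simp
  also have "\<dots> = (\<Oplus>i\<in>{..n}. component a i \<otimes> component b (n - i))"
    using N cl component_homog_mult[OF component_spec(1)[OF a] b]
    by (intro add.finprod_mono_neutral_cong_right) auto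
  finally show ?thesis .
qed

section \<open>The homogeneous core and the degrees of an element modulo it\<close>

text \<open>The largest homogeneous ideal contained in \<open>P\<close>, usually written \<open>P\<^sup>*\<close>.\<close>

definition homog_core :: "'a set \<Rightarrow> 'a set" where
  "homog_core P = {a \<in> carrier R. \<forall>n. component a n \<in> P}"

lemma homog_core_mono: "P \<subseteq> Q \<Longrightarrow> homog_core P \<subseteq> homog_core Q"
  by (auto simp: homog_core_def)

lemma homog_core_subset:
  assumes "ideal P R"
  shows "homog_core P \<subseteq> P"
proof
  fix a assume "a \<in> homog_core P"
  then have a: "a \<in> carrier R" "\<And>n. component a n \<in> P" by (auto simp: homog_core_def)
  have "(\<Oplus>n\<in>{n. component a n \<noteq> \<zero>}. component a n) \<in> P"
    by (rule ideal_finsum_closed[OF assms a(2)])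
  then show "a \<in> P" using component_spec(3)[OF a(1)] by simp
qed

lemma homog_core_ideal:
  assumes "ideal P R"
  shows "ideal (homog_core P) R"
proof (rule idealI)
  interpret P: ideal P R by fact
  show "ring R" ..
  have zero: "\<zero> \<in> homog_core P" by (simp add: homog_core_def)
  show "subgroup (homog_core P) (add_monoid R)"
  proof (rule add.subgroupI)
    show "homog_core P \<noteq> {}" using zero by auto
    fix a assume a: "a \<in> homog_core P"
    then show "\<ominus> a \<in> homog_core P" by (simp add: homog_core_def component_uminus)
    fix b assume "b \<in> homog_core P"
    with a show "a \<oplus> b \<in> homog_core P" by (simp add: homog_core_def component_add)
  qed (auto simp: homog_core_def)
  have mult: "x \<otimes> a \<in> homog_core P" if a: "a \<in> homog_core P" and x: "x \<in> carrier R" for a x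
  proof -
    have a': "a \<in> carrier R" "\<And>n. component a n \<in> P" using a by (auto simp: homog_core_def)
    have "component (x \<otimes> a) n \<in> P" for n
      unfolding component_mult[OF x a'(1)]
      by (intro ideal_finsum_closed[OF P.is_ideal] P.I_l_closed a'(2) component_closed x)
    then show ?thesis using x a' by (simp add: homog_core_def)
  qed
  then show "\<And>a x. a \<in> homog_core P \<Longrightarrow> x \<in> carrier R \<Longrightarrow> x \<otimes> a \<in> homog_core P" .
  show "a \<otimes> x \<in> homog_core P" if "a \<in> homog_core P" "x \<in> carrier R" for a x
    using mult[OF that] that m_comm[of a x] by (simp add: homog_core_def)
qed

text \<open>Modulo the homogeneous core of \<open>P\<close>, the element \<open>a\<close> has lowest degree \<open>s\<close> and highest degree \<open>t\<close>.\<close>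

definition spans :: "'a set \<Rightarrow> 'a \<Rightarrow> nat \<Rightarrow> nat \<Rightarrow> bool" where
  "spans P a s t \<longleftrightarrow> component a s \<notin> P \<and> component a t \<notin> P \<and>
     (\<forall>n. n < s \<or> t < n \<longrightarrow> component a n \<in> P)"

lemma spans_le: "spans P a s t \<Longrightarrow> s \<le> t"
  unfolding spans_def by (metis not_le)

lemma spans_unique:
  assumes "spans P a s t" "spans P a s' t'"
  shows "s = s'" "t = t'"
  using assms unfolding spans_def by (metis nat_neq_iff)+

lemma spans_not_core: "spans P a s t \<Longrightarrow> a \<notin> homog_core P"
  by (auto simp: spans_def homog_core_def)

lemma ex_spans:
  assumes P: "ideal P R" and a: "a \<in> carrier R" "a \<notin> homog_core P"
  obtains s t where "spans P a s t"
proof -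
  interpret P: ideal P R by fact
  let ?N = "{n. component a n \<notin> P}"
  have "?N \<subseteq> {n. component a n \<noteq> \<zero>}" using P.zero_closed by auto
  then have fin: "finite ?N" using component_spec(2)[OF a(1)] by (rule finite_subset)
  have ne: "?N \<noteq> {}" using a by (auto simp: homog_core_def)
  define l m where "l = Min ?N" and "m = Max ?N"
  have "l \<in> ?N" "m \<in> ?N" unfolding l_def m_def by (rule Min_in[OF fin ne] Max_in[OF fin ne])+
  moreover have "component a n \<in> P" if "n < l \<or> m < n" for n
  proof (rule ccontr)
    assume "component a n \<notin> P"
    then have "l \<le> n" "n \<le> m" using Min_le[OF fin, of n] Max_ge[OF fin, of n] by (simp_all add: l_def m_def)
    with that show False by simp
  qed
  ultimately have "spans P a l m" unfolding spans_def by simp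
  then show thesis by (rule that)
qed

lemma component_mult_mem:
  assumes P: "ideal P R" and a: "a \<in> carrier R" and b: "b \<in> carrier R"
    and "\<And>i. i \<le> n \<Longrightarrow> component a i \<in> P \<or> component b (n - i) \<in> P"
  shows "component (a \<otimes> b) n \<in> P"
  unfolding component_mult[OF a b]
proof (rule ideal_finsum_closed[OF P])
  interpret P: ideal P R by fact
  fix i assume "i \<in> {..n}"
  then show "component a i \<otimes> component b (n - i) \<in> P"
    using assms(4)[of i] P.I_l_closed P.I_r_closed component_closed a b by auto
qed

text \<open>All terms of the convolution but one lie in \<open>P\<close>, and the remaining one is a
  product of two elements outside a prime.\<close>

lemma component_mult_not_mem:
  assumes P: "primeideal P R" and a: "a \<in> carrier R" and b: "b \<in> carrier R"
    and k: "component a k \<notin> P" "component b l \<notin> P"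
    and other: "\<And>i. i \<le> k + l \<Longrightarrow> i \<noteq> k \<Longrightarrow> component a i \<in> P \<or> component b (k + l - i) \<in> P"
  shows "component (a \<otimes> b) (k + l) \<notin> P"
proof
  interpret P: primeideal P R by fact
  assume mem: "component (a \<otimes> b) (k + l) \<in> P"
  let ?f = "\<lambda>i. component a i \<otimes> component b (k + l - i)"
  have cl: "component a i \<in> carrier R" "component b i \<in> carrier R" for i
    using component_closed a b by auto
  have rest: "(\<Oplus>i\<in>{..k + l} - {k}. ?f i) \<in> P"
    using other P.I_l_closed P.I_r_closed cl by (intro ideal_finsum_closed[OF P.is_ideal]) fastforce
  have rc: "(\<Oplus>i\<in>{..k + l} - {k}. ?f i) \<in> carrier R" using rest by simp
  have "component (a \<otimes> b) (k + l) = (\<Oplus>i\<in>insert k ({..k + l} - {k}). ?f i)"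
    unfolding component_mult[OF a b] by (simp add: insert_absorb)
  also have "\<dots> = ?f k \<oplus> (\<Oplus>i\<in>{..k + l} - {k}. ?f i)"
    using cl by (intro finsum_insert) auto
  finally have "?f k = component (a \<otimes> b) (k + l) \<ominus> (\<Oplus>i\<in>{..k + l} - {k}. ?f i)"
    using cl rc by (simp add: minus_eq add.m_assoc r_neg)
  also have "\<dots> \<in> P" using mem rest by (simp add: minus_eq)
  finally have "component a k \<otimes> component b l \<in> P" by simp
  then show False using P.I_prime cl k by blast
qed

text \<open>As over a graded domain, extreme degrees add: the lowest and the highest degree of a
  product each arise, modulo \<open>P\<close>, from one pair of components. Widths are therefore
  additive.\<close>

lemma spans_mult:
  assumes P: "primeideal P R" and a: "a \<in> carrier R" "spans P a s t" and b: "b \<in> carrier R" "spans P b u v"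
  shows "spans P (a \<otimes> b) (s + u) (t + v)"
proof -
  interpret P: primeideal P R by fact
  have A: "component a s \<notin> P" "component a t \<notin> P" "\<And>n. n < s \<Longrightarrow> component a n \<in> P" "\<And>n. t < n \<Longrightarrow> component a n \<in> P"
    using a(2) by (auto simp: spans_def)
  have B: "component b u \<notin> P" "component b v \<notin> P" "\<And>n. n < u \<Longrightarrow> component b n \<in> P" "\<And>n. v < n \<Longrightarrow> component b n \<in> P"
    using b(2) by (auto simp: spans_def)
  have "component (a \<otimes> b) (s + u) \<notin> P"
  proof (rule component_mult_not_mem[OF P a(1) b(1) A(1) B(1)])
    fix i assume "i \<le> s + u" "i \<noteq> s"
    then have "i < s \<or> s + u - i < u" by linarith
    then show "component a i \<in> P \<or> component b (s + u - i) \<in> P" using A(3) B(3) by auto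
  qed
  moreover have "component (a \<otimes> b) (t + v) \<notin> P"
  proof (rule component_mult_not_mem[OF P a(1) b(1) A(2) B(2)])
    fix i assume "i \<le> t + v" "i \<noteq> t"
    then have "t < i \<or> v < t + v - i" by linarith
    then show "component a i \<in> P \<or> component b (t + v - i) \<in> P" using A(4) B(4) by auto
  qed
  moreover have "component (a \<otimes> b) n \<in> P" if n: "n < s + u \<or> t + v < n" for n
  proof (rule component_mult_mem[OF P.is_ideal a(1) b(1)])
    fix i assume "i \<le> n"
    with n have "i < s \<or> n - i < u \<or> t < i \<or> v < n - i" by linarith
    then show "component a i \<in> P \<or> component b (n - i) \<in> P" using A(3,4) B(3,4) by auto
  qed
  ultimately show ?thesis by (simp add: spans_def)
qed

text \<open>Elements outside the core are those with a lowest and a highest degree modulo it, and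
  such elements are closed under products.\<close>

lemma homog_core_primeideal:
  assumes P: "primeideal P R"
  shows "primeideal (homog_core P) R"
proof (rule primeidealI[OF _ is_cring])
  interpret P: primeideal P R by fact
  show "ideal (homog_core P) R" by (rule homog_core_ideal[OF P.is_ideal])
  show "carrier R \<noteq> homog_core P"
    using homog_core_subset[OF P.is_ideal] P.I_notcarr P.a_subset by auto
  fix a b assume a: "a \<in> carrier R" and b: "b \<in> carrier R" and ab: "a \<otimes> b \<in> homog_core P"
  show "a \<in> homog_core P \<or> b \<in> homog_core P"
  proof (rule ccontr)
    assume n: "\<not> (a \<in> homog_core P \<or> b \<in> homog_core P)"
    obtain s t where st: "spans P a s t" using ex_spans[OF P.is_ideal a] n by auto
    obtain u v where uv: "spans P b u v" using ex_spans[OF P.is_ideal b] n by auto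
    show False using spans_not_core[OF spans_mult[OF P a st b uv]] ab by simp
  qed
qed

lemma spans_cong:
  assumes P: "ideal P R" and a: "a \<in> carrier R" and b: "b \<in> carrier R" and ab: "a \<ominus> b \<in> homog_core P"
    and "spans P a s t"
  shows "spans P b s t"
proof -
  interpret P: ideal P R by fact
  have "component a n \<in> P \<longleftrightarrow> component b n \<in> P" for n
  proof -
    have cl: "component a n \<in> carrier R" "component b n \<in> carrier R" using component_closed a b by auto
    have d: "component a n \<ominus> component b n \<in> P"
      using ab a b by (simp add: homog_core_def component_minus)
    have "component a n = (component a n \<ominus> component b n) \<oplus> component b n" using cl by algebra
    moreover have "component b n = component a n \<ominus> (component a n \<ominus> component b n)" using cl by algebra
    ultimately show ?thesis using d P.a_closed P.a_inv_closed unfolding minus_eq by metis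
  qed
  then show ?thesis using assms(5) by (simp add: spans_def)
qed

lemma spans_homog:
  assumes "ideal P R" "a \<in> G d" "a \<notin> P"
  shows "spans P a d d"
proof -
  interpret P: ideal P R by fact
  show ?thesis using assms(2,3) by (auto simp: spans_def component_homog)
qed

section \<open>Primes between a prime and its homogeneous core\<close>

text \<open>Pseudo-division by an element of minimal width: cancelling top components lowers the width.\<close>

lemma pseudo_division:
  assumes P: "primeideal P R" and g: "g \<in> P" "spans P g u (u + w)"
    and minimal: "\<And>h s w'. h \<in> P \<Longrightarrow> spans P h s (s + w') \<Longrightarrow> w \<le> w'"
    and h: "h \<in> P"
  shows "\<exists>d a r. a \<in> G d \<and> a \<notin> P \<and> r \<in> carrier R \<and> a \<otimes> h \<ominus> r \<otimes> g \<in> homog_core P"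
proof -
  interpret P: primeideal P R by fact
  have gc: "g \<in> carrier R" using g by simp
  have core: "\<exists>d a r. a \<in> G d \<and> a \<notin> P \<and> r \<in> carrier R \<and> a \<otimes> h \<ominus> r \<otimes> g \<in> homog_core P"
    if h: "h \<in> homog_core P" for h
  proof (intro exI conjI)
    show "\<one> \<in> G 0" by (rule G_one)
    show "\<one> \<notin> P" using P.I_notcarr P.one_imp_carrier by auto
    show "\<zero> \<in> carrier R" by simp
    have "h \<in> carrier R" using h by (simp add: homog_core_def)
    then have "\<one> \<otimes> h \<ominus> \<zero> \<otimes> g = h" using gc by algebra
    then show "\<one> \<otimes> h \<ominus> \<zero> \<otimes> g \<in> homog_core P" using h by simp
  qed
  have main: "\<exists>d a r. a \<in> G d \<and> a \<notin> P \<and> r \<in> carrier R \<and> a \<otimes> h \<ominus> r \<otimes> g \<in> homog_core P"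
    if "h \<in> P" "spans P h s (s + w')" for h s w'
    using that
  proof (induction w' arbitrary: h s rule: less_induct)
    case (less w')
    have hc: "h \<in> carrier R" using less.prems by simp
    define t where "t = u + w"
    define v where "v = s + w'"
    \<comment> \<open>\<open>a0\<close> and \<open>b0\<close> are the top components of
      \<open>g\<close> and \<open>h\<close>, so their product cancels in degree \<open>t + v\<close>
      of \<open>h'\<close>. As \<open>a0\<close> is homogeneous and outside \<open>P\<close>, it is
      an admissible multiplier.\<close>
    define a0 where "a0 = component g t"
    define b0 where "b0 = component h v"
    define h' where "h' = a0 \<otimes> h \<ominus> b0 \<otimes> g"
    have a0: "a0 \<in> G t" "a0 \<in> carrier R" "a0 \<notin> P"
      using component_spec(1)[OF gc] component_closed[OF gc] g(2) by (auto simp: a0_def t_def spans_def)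
    have b0: "b0 \<in> G v" "b0 \<in> carrier R"
      using component_spec(1)[OF hc] component_closed[OF hc] by (auto simp: b0_def)
    have gP: "\<And>n. n < u \<or> t < n \<Longrightarrow> component g n \<in> P" using g(2) by (auto simp: spans_def t_def)
    have hP: "\<And>n. n < s \<or> v < n \<Longrightarrow> component h n \<in> P" using less.prems(2) by (auto simp: spans_def v_def)
    have h'P: "h' \<in> P"
      unfolding h'_def minus_eq using less.prems(1) g(1) a0 b0 P.I_l_closed by auto
    have h'c: "h' \<in> carrier R" using h'P by simp
    show ?case
    proof (cases "h' \<in> homog_core P")
      case True
      then show ?thesis unfolding h'_def using a0 b0 by blast
    next
      case False
      obtain s1 t1 where sp: "spans P h' s1 t1" by (rule ex_spans[OF P.is_ideal h'c False])
      have comp: "component h' n = component (a0 \<otimes> h) n \<ominus> component (b0 \<otimes> g) n" for n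
        unfolding h'_def using a0 b0 hc gc by (intro component_minus) auto
      have mem: "component h' n \<in> P" if "component (a0 \<otimes> h) n \<in> P" "component (b0 \<otimes> g) n \<in> P" for n
        unfolding comp minus_eq using that by auto
      \<comment> \<open>Minimality of \<open>w\<close> enters here: \<open>b0 \<otimes> g\<close>
        starts, modulo \<open>P\<close>, no lower than \<open>a0 \<otimes> h\<close>, as
        \<open>v + u \<ge> t + s\<close>.\<close>
      have ww': "w \<le> w'" using minimal[OF less.prems] .
      have t1: "t1 < t + v"
      proof (rule ccontr)
        assume ge: "\<not> t1 < t + v"
        have "component h' t1 \<in> P"
        proof (cases "t1 = t + v")
          case True
          have "component h' t1 = a0 \<otimes> b0 \<ominus> b0 \<otimes> a0"
            unfolding comp using True hc gc
            by (simp add: component_homog_mult[OF a0(1)] component_homog_mult[OF b0(1)]) (simp add: a0_def b0_def)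
          also have "\<dots> = \<zero>" using a0 b0 by algebra
          finally show ?thesis by simp
        next
          case False
          then have "v < t1 - t" "t < t1 - v" using ge by linarith+
          then have "component h (t1 - t) \<in> P" "component g (t1 - v) \<in> P" using hP gP by auto
          then show ?thesis
            using a0 b0 P.I_l_closed hc gc
            by (intro mem) (auto simp: component_homog_mult[OF a0(1)] component_homog_mult[OF b0(1)])
        qed
        then show False using sp by (simp add: spans_def)
      qed
      have s1: "t + s \<le> s1"
      proof (rule ccontr)
        assume lt: "\<not> t + s \<le> s1"
        then have "t \<le> s1 \<Longrightarrow> s1 - t < s" "v \<le> s1 \<Longrightarrow> s1 - v < u"
          using ww' by (auto simp: t_def v_def)
        then have "t \<le> s1 \<Longrightarrow> component h (s1 - t) \<in> P" "v \<le> s1 \<Longrightarrow> component g (s1 - v) \<in> P"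
          using hP gP by auto
        then have "component h' s1 \<in> P"
          using a0 b0 P.I_l_closed hc gc
          by (intro mem) (auto simp: component_homog_mult[OF a0(1)] component_homog_mult[OF b0(1)])
        then show False using sp by (simp add: spans_def)
      qed
      have "spans P h' s1 (s1 + (t1 - s1))" using sp spans_le[OF sp] by simp
      \<comment> \<open>The degrees of \<open>h'\<close> run from at least \<open>t + s\<close> to
        less than \<open>t + v\<close>, and \<open>v - s = w'\<close>.\<close>
      moreover have "t1 - s1 < w'" using t1 s1 spans_le[OF sp] by (simp add: v_def)
      ultimately obtain d a r where a: "a \<in> G d" "a \<notin> P" and r: "r \<in> carrier R"
        and c: "a \<otimes> h' \<ominus> r \<otimes> g \<in> homog_core P"
        using less.IH[OF _ h'P] by blast
      have ac: "a \<in> carrier R" using a by (simp add: G_carrier)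
      have "a \<otimes> h' \<ominus> r \<otimes> g = (a \<otimes> a0) \<otimes> h \<ominus> (a \<otimes> b0 \<oplus> r) \<otimes> g"
        unfolding h'_def using ac a0(2) b0(2) r hc gc by algebra
      moreover have "a \<otimes> a0 \<in> G (d + t)" "a \<otimes> a0 \<notin> P" "a \<otimes> b0 \<oplus> r \<in> carrier R"
        using G_mult[OF a(1) a0(1)] P.I_prime[OF ac a0(2)] a(2) a0(3) ac b0(2) r by auto
      ultimately show ?thesis using c by metis
    qed
  qed
  show ?thesis
  proof (cases "h \<in> homog_core P")
    case False
    obtain s t where st: "spans P h s t" by (rule ex_spans[OF P.is_ideal P.Icarr[OF h] False])
    then show ?thesis using main[OF h, of s "t - s"] spans_le[OF st] by simp
  qed (rule core)
qed

text \<open>In the ring of fractions of \<open>R/P\<^sup>*\<close> with homogeneous denominators every nonzero prime is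
  maximal, and a generator of the image of \<open>P\<close> is an element of minimal width.\<close>

lemma no_prime_between_homog_core:
  assumes P: "primeideal P R" and Q: "primeideal Q R" and CQ: "homog_core P \<subseteq> Q" and QP: "Q \<subset> P"
  shows "Q \<subseteq> homog_core P"
proof (rule ccontr)
  assume "\<not> Q \<subseteq> homog_core P"
  then obtain f0 where f0: "f0 \<in> Q" "f0 \<notin> homog_core P" by auto
  interpret P: primeideal P R by fact
  interpret Q: primeideal Q R by fact
  interpret C: primeideal "homog_core P" R by (rule homog_core_primeideal[OF P])
  let ?W = "\<lambda>I w. \<exists>h s. h \<in> I \<and> spans P h s (s + w)"
  have "\<exists>w. ?W I w" if "f0 \<in> I" for I
  proof -
    obtain s t where st: "spans P f0 s t" by (rule ex_spans[OF P.is_ideal Q.Icarr[OF f0(1)] f0(2)])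
    then have "spans P f0 s (s + (t - s))" using spans_le[OF st] by simp
    with that show ?thesis by auto
  qed
  then have ex: "\<exists>w. ?W Q w" "\<exists>w. ?W P w" using f0(1) QP by auto
  define w where "w = (LEAST w. ?W P w)"
  define wf where "wf = (LEAST w. ?W Q w)"
  obtain g u where g: "g \<in> P" "spans P g u (u + w)" using LeastI_ex[OF ex(2)] unfolding w_def by auto
  obtain f s where f: "f \<in> Q" "spans P f s (s + wf)" using LeastI_ex[OF ex(1)] unfolding wf_def by auto
  have min: "w \<le> w'" if "h \<in> P" "spans P h s (s + w')" for h s w'
    unfolding w_def using that by (intro Least_le) auto
  have minQ: "wf \<le> w'" if "h \<in> Q" "spans P h s (s + w')" for h s w'
    unfolding wf_def using that by (intro Least_le) auto
  have gc: "g \<in> carrier R" using g by simp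
  have div: "\<exists>d a r. a \<in> G d \<and> a \<notin> P \<and> r \<in> carrier R \<and> a \<otimes> h \<ominus> r \<otimes> g \<in> homog_core P"
    if "h \<in> P" for h using pseudo_division[OF P g min that] .
  show False
  proof (cases "g \<in> Q")
    case True
    \<comment> \<open>Pseudo-division by \<open>g \<in> Q\<close> leaves a remainder in the core,
      hence in \<open>Q\<close>, and its multiplier \<open>a \<notin> P\<close> can be cancelled
      modulo \<open>Q\<close>. So all of \<open>P\<close> falls into \<open>Q\<close>.\<close>
    have "h \<in> Q" if h: "h \<in> P" for h
    proof -
      obtain d a r where a: "a \<in> G d" "a \<notin> P" and r: "r \<in> carrier R"
        and c: "a \<otimes> h \<ominus> r \<otimes> g \<in> homog_core P" using div[OF h] by auto
      have ac: "a \<in> carrier R" "h \<in> carrier R" using a h by (simp_all add: G_carrier)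
      have "a \<otimes> h = (a \<otimes> h \<ominus> r \<otimes> g) \<oplus> r \<otimes> g" using ac r gc by algebra
      also have "\<dots> \<in> Q" using c CQ True r Q.I_l_closed by auto
      finally show ?thesis using Q.I_prime[OF ac] a QP by auto
    qed
    with QP show False by auto
  next
    case False
    have fP: "f \<in> P" and fc: "f \<in> carrier R" using f QP by auto
    obtain d a r where a: "a \<in> G d" "a \<notin> P" and r: "r \<in> carrier R"
      and c: "a \<otimes> f \<ominus> r \<otimes> g \<in> homog_core P" using div[OF fP] by auto
    have ac: "a \<in> carrier R" using a by (simp add: G_carrier)
    \<comment> \<open>The quotient \<open>r\<close> inherits membership in \<open>Q\<close> from
      \<open>f\<close>, since \<open>g \<notin> Q\<close>; it will compete with \<open>f\<close> for
      minimal width in \<open>Q\<close>.\<close>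
    have eq: "r \<otimes> g = a \<otimes> f \<ominus> (a \<otimes> f \<ominus> r \<otimes> g)" using ac fc r gc by algebra
    have "a \<otimes> f \<ominus> (a \<otimes> f \<ominus> r \<otimes> g) \<in> Q" using f(1) ac c CQ Q.I_l_closed unfolding minus_eq by auto
    then have rQ: "r \<in> Q" using eq Q.I_prime[OF r gc] False by auto
    have af: "spans P (a \<otimes> f) (d + s) (d + (s + wf))"
      using spans_mult[OF P ac spans_homog[OF P.is_ideal a] fc f(2)] .
    have rg: "spans P (r \<otimes> g) (d + s) (d + (s + wf))"
      using spans_cong[OF P.is_ideal _ _ c af] ac fc r gc by simp
    have rC: "r \<notin> homog_core P"
      using spans_not_core[OF rg] C.I_r_closed[of r g] gc by auto
    obtain x y where xy: "spans P r x y" by (rule ex_spans[OF P.is_ideal r rC])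
    \<comment> \<open>The width \<open>wf\<close> is that of \<open>r\<close> plus \<open>w\<close>,
      while \<open>r \<in> Q\<close> has width at least \<open>wf\<close>. This leaves no room for a
      positive \<open>w\<close>.\<close>
    have "d + s = x + u" "d + (s + wf) = y + (u + w)"
      using spans_unique[OF rg spans_mult[OF P r xy gc g(2)]] by simp_all
    moreover have "wf \<le> y - x" using minQ[OF rQ, of x "y - x"] xy spans_le[OF xy] by simp
    ultimately have "w = 0" using spans_le[OF xy] by linarith
    then have gu: "spans P g u u" using g(2) by simp
    \<comment> \<open>An element of width 0 is homogeneous modulo the core, so its only surviving
      component lies in \<open>P\<close> along with \<open>g\<close>, against the choice of
      \<open>u\<close>.\<close>
    have "g \<ominus> component g u \<in> homog_core P"
    proof -
      have cc: "component g u \<in> carrier R" using component_closed[OF gc] .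
      have "component (g \<ominus> component g u) n \<in> P" for n
        unfolding component_minus[OF gc cc] component_homog[OF component_spec(1)[OF gc]]
        using gu component_closed[OF gc] by (auto simp: spans_def minus_eq r_neg nat_neq_iff)
      moreover have "g \<ominus> component g u \<in> carrier R" using gc cc by (rule minus_closed)
      ultimately show ?thesis unfolding homog_core_def by blast
    qed
    then have d: "g \<ominus> component g u \<in> P" using homog_core_subset[OF P.is_ideal] by auto
    have "component g u = g \<ominus> (g \<ominus> component g u)" using gc component_closed[OF gc, of u] by algebra
    also have "\<dots> \<in> P" using d g(1) unfolding minus_eq by auto
    finally show False using gu by (simp add: spans_def)
  qed
qed

text \<open>The height of a prime exceeds that of its core by at most one. If the next-to-last prime
  is not inside the core of the top, the chain found below that prime can be extended by this
  core.\<close>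

lemma prime_chain_below_homog_core:
  assumes "prime_chain R P (Suc n)"
  shows "\<exists>Q. prime_chain R Q n \<and> Q n \<subseteq> homog_core (P (Suc n))"
  using assms
proof (induction n)
  case 0
  then have "primeideal (homog_core (P (Suc 0))) R"
    by (intro homog_core_primeideal) (simp add: prime_chain_def)
  then have "prime_chain R (\<lambda>_. homog_core (P (Suc 0))) 0" by (simp add: prime_chain_def)
  then show ?case by auto
next
  case (Suc n)
  let ?T = "P (Suc (Suc n))"
  let ?C = "homog_core ?T"
  have T: "primeideal ?T R" and P: "primeideal (P (Suc n)) R" and PT: "P (Suc n) \<subset> ?T"
    using Suc.prems by (auto simp: prime_chain_def)
  have prefix: "prime_chain R P (Suc n)" using prime_chain_mono[OF Suc.prems] by simp
  show ?case
  proof (cases "P (Suc n) \<subseteq> ?C")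
    case True
    with prefix show ?thesis by auto
  next
    case False
    obtain Q where Q: "prime_chain R Q n" "Q n \<subseteq> homog_core (P (Suc n))"
      using Suc.IH[OF prefix] by auto
    have sub: "homog_core (P (Suc n)) \<subseteq> ?C" using homog_core_mono PT by auto
    \<comment> \<open>Equality would place \<open>P (Suc n)\<close> strictly between
      \<open>?C\<close> and \<open>?T\<close>.\<close>
    have "Q n \<noteq> ?C"
    proof
      assume "Q n = ?C"
      then have "?C \<subseteq> P (Suc n)"
        using Q(2) homog_core_subset[of "P (Suc n)"] P by (auto simp: primeideal_def)
      then show False using no_prime_between_homog_core[OF T P _ PT] False by simp
    qed
    then have "Q n \<subset> ?C" using Q(2) sub by auto
    then have "prime_chain R (Q(Suc n := ?C)) (Suc n)"
      by (intro prime_chain_update[OF Q(1) homog_core_primeideal[OF T]])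
    moreover have "(Q(Suc n := ?C)) (Suc n) \<subseteq> ?C" by simp
    ultimately show ?thesis by blast
  qed
qed

section \<open>Homogeneous elements and the local degree zero part\<close>

lemma degree_zero_inclusion:
  assumes "local_ring (R\<lparr>carrier := G 0\<rparr>)"
  shows "ring_hom_ring (R\<lparr>carrier := G 0\<rparr>) R id"
proof (rule ring_hom_ringI2)
  show "ring (R\<lparr>carrier := G 0\<rparr>)" using assms by (simp add: local_ring_def cring_def)
  show "ring R" ..
  show "id \<in> ring_hom (R\<lparr>carrier := G 0\<rparr>) R"
    by (rule ring_hom_memI) (auto intro: G_carrier)
qed

text \<open>A unit of the degree zero part is a unit of \<open>R\<close>, and the nonunits of a
  local ring lie in its maximal ideal.\<close>

lemma mem_degree_zero_max_ideal:
  assumes loc: "local_ring (R\<lparr>carrier := G 0\<rparr>)" and x: "x \<in> G 0"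
    and proper: "PIdl x \<noteq> carrier R"
  shows "x \<in> the_max_ideal (R\<lparr>carrier := G 0\<rparr>)"
proof -
  let ?S = "R\<lparr>carrier := G 0\<rparr>"
  interpret S: cring ?S using loc by (simp add: local_ring_def)
  have xS: "x \<in> carrier ?S" using x by simp
  have xc: "x \<in> carrier R" using x by (rule G_carrier)
  interpret I: ideal "PIdl x" R by (rule cgenideal_ideal[OF xc])
  have "PIdl\<^bsub>?S\<^esub> x \<noteq> carrier ?S"
  proof
    assume "PIdl\<^bsub>?S\<^esub> x = carrier ?S"
    then have "\<one> \<in> PIdl\<^bsub>?S\<^esub> x" using G_one by simp
    then have "\<one> \<in> PIdl x" unfolding cgenideal_def using G_carrier by auto
    then show False using proper I.one_imp_carrier by simp
  qed
  with S.cgenideal_ideal[OF xS] have "PIdl\<^bsub>?S\<^esub> x \<subseteq> the_max_ideal ?S"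
    by (rule S.proper_ideal_le_the_max_ideal[OF loc])
  then show ?thesis using S.cgenideal_self[OF xS] by (rule subsetD)
qed

text \<open>Compare degree zero parts in \<open>\<one> = c \<oplus> r \<otimes> x\<close>. For
  \<open>d > 0\<close> only \<open>component c 0 \<in> P\<close> is left; for \<open>d = 0\<close>
  both summands lie in the maximal ideal of the degree zero part.\<close>

lemma homog_core_sum_proper:
  assumes loc: "local_ring (R\<lparr>carrier := G 0\<rparr>)" and P: "primeideal P R"
    and x: "x \<in> G d" "PIdl x \<noteq> carrier R"
  shows "homog_core P <+>\<^bsub>R\<^esub> PIdl x \<noteq> carrier R"
proof
  let ?S = "R\<lparr>carrier := G 0\<rparr>"
  let ?n = "the_max_ideal ?S"
  interpret P: primeideal P R by fact
  interpret S: cring ?S using loc by (simp add: local_ring_def)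
  interpret n: maximalideal ?n ?S by (rule maximalideal_the_max_ideal[OF loc])
  have one_P: "\<one> \<notin> P" using P.I_notcarr P.one_imp_carrier by auto
  have one_n: "\<one> \<notin> ?n" using n.I_notcarr n.one_imp_carrier by auto
  have xc: "x \<in> carrier R" using x(1) by (rule G_carrier)
  assume "homog_core P <+>\<^bsub>R\<^esub> PIdl x = carrier R"
  then have "\<one> \<in> homog_core P <+>\<^bsub>R\<^esub> PIdl x" by simp
  then obtain c r where c: "c \<in> homog_core P" and r: "r \<in> carrier R" and eq: "\<one> = c \<oplus> r \<otimes> x"
    unfolding mem_ideal_sum_PIdl_iff by auto
  have cc: "c \<in> carrier R" "component c 0 \<in> P" using c by (auto simp: homog_core_def)
  have "\<one> = component (c \<oplus> x \<otimes> r) 0" using component_homog[OF G_one, of 0] eq m_comm[OF r xc] by simp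
  also have "\<dots> = component c 0 \<oplus> component (x \<otimes> r) 0" using cc(1) xc r by (simp add: component_add)
  finally have one: "\<one> = component c 0 \<oplus> component (x \<otimes> r) 0" .
  show False
  proof (cases "d = 0")
    case False
    then have "\<one> = component c 0" using one component_homog_mult[OF x(1) r, of 0] component_closed[OF cc(1)] by simp
    with cc(2) one_P show False by simp
  next
    case True
    then have xn: "x \<in> ?n" using mem_degree_zero_max_ideal[OF loc] x by simp
    have "component r 0 \<in> carrier ?S" using component_spec(1)[OF r] by simp
    then have "x \<otimes> component r 0 \<in> ?n" using n.I_r_closed[OF xn] by simp
    then have 2: "component (x \<otimes> r) 0 \<in> ?n" using component_homog_mult[OF x(1) r, of 0] True by simp
    \<comment> \<open>The contraction of \<open>P\<close> to degree zero is proper, hence inside the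
      maximal ideal there.\<close>
    let ?P0 = "{a \<in> carrier ?S. id a \<in> P}"
    have P0: "ideal ?P0 ?S"
      by (rule ring_hom_ring.ideal_vimage[OF degree_zero_inclusion[OF loc] P.is_ideal])
    have "?P0 \<noteq> carrier ?S" using one_P G_one by auto
    with P0 have "?P0 \<subseteq> ?n" by (rule S.proper_ideal_le_the_max_ideal[OF loc])
    then have "component c 0 \<in> ?n" using cc component_spec(1)[OF cc(1)] by auto
    then have "component c 0 \<oplus> component (x \<otimes> r) 0 \<in> ?n" using n.a_closed[OF _ 2] by simp
    with one one_n show False by simp
  qed
qed

lemma prime_chain_ending_through_homogeneous:
  assumes loc: "local_ring (R\<lparr>carrier := G 0\<rparr>)" and x: "x \<in> G d" "PIdl x \<noteq> carrier R"
    and P: "prime_chain R P (Suc n)"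
  shows "\<exists>Q. prime_chain R Q (Suc n) \<and> x \<in> Q (Suc n)"
proof (cases "x \<in> P (Suc n)")
  case True
  with P show ?thesis by auto
next
  case False
  let ?C = "homog_core (P (Suc n))"
  have xc: "x \<in> carrier R" using x(1) by (rule G_carrier)
  have prime: "primeideal (P (Suc n)) R" using P by (simp add: prime_chain_def)
  then have idl: "ideal (P (Suc n)) R" by (simp add: primeideal_def)
  obtain Q where Q: "prime_chain R Q n" "Q n \<subseteq> ?C" using prime_chain_below_homog_core[OF P] by auto
  note Cx = ideal_sum_PIdl[OF homog_core_ideal[OF idl] xc]
  obtain M where M: "maximalideal M R" "?C <+>\<^bsub>R\<^esub> PIdl x \<subseteq> M"
    by (rule proper_ideal_in_maximalideal[OF Cx(1) homog_core_sum_proper[OF loc prime x]])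
  have xM: "x \<in> M" using M(2) Cx(3) by auto
  \<comment> \<open>The element \<open>x\<close> itself makes the inclusion strict: it lies in
    \<open>M\<close>, but not in \<open>Q n\<close>, which is contained in
    \<open>P (Suc n)\<close>.\<close>
  have "Q n \<subseteq> M" using Q(2) Cx(2) M(2) by auto
  moreover have "x \<notin> Q n" using Q(2) homog_core_subset[OF idl] False by auto
  ultimately have "Q n \<subset> M" using xM by auto
  then have "prime_chain R (Q(Suc n := M)) (Suc n)"
    by (rule prime_chain_update[OF Q(1) maximalideal_prime[OF M(1)]])
  moreover have "x \<in> (Q(Suc n := M)) (Suc n)" using xM by simp
  ultimately show ?thesis by blast
qed

text \<open>The projection restricts to a surjection between the local degree zero parts; this
  treats the first summand, and images of generated ideals treat the second.\<close>

lemma homog_max_ideal_quot: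
  assumes I: "ideal I R" and loc: "local_ring (R\<lparr>carrier := G 0\<rparr>)"
    and loc': "local_ring ((R Quot I)\<lparr>carrier := quot_grading R I G 0\<rparr>)"
  shows "(+>) I ` homog_max_ideal R G = homog_max_ideal (R Quot I) (quot_grading R I G)"
proof -
  let ?A = "R Quot I" and ?h = "(+>) I"
  let ?S = "R\<lparr>carrier := G 0\<rparr>" and ?T = "(R Quot I)\<lparr>carrier := quot_grading R I G 0\<rparr>"
  interpret I: ideal I R by (rule I)
  interpret h: ring_hom_ring R ?A ?h by (rule I.rcos_ring_hom_ring)
  have "ring_hom_ring ?S ?T ?h"
  proof (rule ring_hom_ringI2)
    show "ring ?S" "ring ?T" using loc loc' by (simp_all add: local_ring_def cring_def)
    show "?h \<in> ring_hom ?S ?T"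
      by (rule ring_hom_memI) (auto simp: quot_grading_def G_carrier)
  qed
  then have max: "?h ` the_max_ideal ?S = the_max_ideal ?T"
    using loc loc' by (intro ring_hom_ring.the_max_ideal_image) (auto simp: quot_grading_def)
  have "the_max_ideal ?S \<subseteq> G 0"
    using maximalideal_the_max_ideal[OF loc] additive_subgroup.a_subset
    by (fastforce simp: maximalideal_def ideal_def)
  then have nc: "the_max_ideal ?S \<subseteq> carrier R" using G_carrier by auto
  let ?U = "\<Union>n\<in>{0<..}. G n"
  have U: "?U \<subseteq> carrier R" using G_carrier by auto
  have "?h ` ?U = (\<Union>n\<in>{0<..}. quot_grading R I G n)" by (auto simp: quot_grading_def)
  then have "?h ` (Idl ?U) = Idl\<^bsub>?A\<^esub> (\<Union>n\<in>{0<..}. quot_grading R I G n)"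
    using h.genideal_image[OF carrier_quot[symmetric] U] by simp
  moreover have "Idl ?U \<subseteq> carrier R"
    using genideal_ideal[OF U] by (simp add: ideal_def additive_subgroup.a_subset)
  ultimately show ?thesis
    unfolding homog_max_ideal_def using set_add_hom[OF I.rcos_ring_hom nc] max by simp
qed

end

section \<open>The graded case and the conclusion\<close>

theorem weakly_F_nilpotent_graded_of_quotient:
  fixes R (structure)
  assumes R: "graded_ring R G p" and xG: "x \<in> G d" and x: "F_depth_element R (homog_max_ideal R G) p x"
    and A: "weakly_F_nilpotent_graded (R Quot PIdl x) (quot_grading R (PIdl x) G) p"
  shows "weakly_F_nilpotent_graded R G p"
  unfolding weakly_F_nilpotent_graded_def
proof (intro conjI allI impI R)
  interpret noetherian_cring R
    using R by (simp add: noetherian_cring_def graded_ring_def nat_graded_def)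
  interpret nat_graded_ring R G
    using R by unfold_locales (simp add: graded_ring_def)
  let ?I = "PIdl x"
  have loc: "local_ring (R\<lparr>carrier := G 0\<rparr>)" using R by (simp add: graded_ring_def)
  have locA: "local_ring ((R Quot ?I)\<lparr>carrier := quot_grading R ?I G 0\<rparr>)"
    and nt: "\<one>\<^bsub>R Quot ?I\<^esub> \<noteq> \<zero>\<^bsub>R Quot ?I\<^esub>"
    using A by (simp_all add: weakly_F_nilpotent_graded_def graded_ring_def has_prime_char_def)
  have xc: "x \<in> carrier R" using xG by (rule G_carrier)
  have I: "ideal ?I R" by (rule cgenideal_ideal[OF xc])
  \<comment> \<open>The degree zero part of the quotient shares its zero and one, so its prime
    characteristic excludes the zero ring.\<close>
  have proper: "?I \<noteq> carrier R" by (rule ideal_proper_of_quot_nontrivial[OF I nt])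
  fix j assume j: "enat j < krull_dim R"
  show "lc_nilpotent R (homog_max_ideal R G) (algebra_via id R) p j"
  proof (rule lc_nilpotent_below_dim[OF x homog_max_ideal_quot[OF I loc locA] _ _ j])
    show "lc_nilpotent (R Quot ?I) (homog_max_ideal (R Quot ?I) (quot_grading R ?I G))
        (algebra_via id (R Quot ?I)) p j" if "enat j < krull_dim (R Quot ?I)" for j
      using A that by (simp add: weakly_F_nilpotent_graded_def)
    show "\<exists>Q. prime_chain R Q (Suc n) \<and> x \<in> Q (Suc n)" if "prime_chain R P (Suc n)" for P n
      using prime_chain_ending_through_homogeneous[OF loc xG proper that] .
  qed
qed

theorem theorem5p13:
  fixes R :: "('a, 'm) ring_scheme" and G :: "nat \<Rightarrow> 'a set" and p :: nat and x :: 'a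
  shows "(noetherian_local_ring R p
            \<and> F_depth_element R (the_max_ideal R) p x
            \<and> weakly_F_nilpotent_local (R Quot PIdl\<^bsub>R\<^esub> x) p
          \<longrightarrow> weakly_F_nilpotent_local R p)
       \<and> (graded_ring R G p
            \<and> (\<exists>n. x \<in> G n)
            \<and> F_depth_element R (homog_max_ideal R G) p x
            \<and> weakly_F_nilpotent_graded (R Quot PIdl\<^bsub>R\<^esub> x) (quot_grading R (PIdl\<^bsub>R\<^esub> x) G) p
          \<longrightarrow> weakly_F_nilpotent_graded R G p)"
proof (intro conjI impI; elim conjE exE)
  assume "noetherian_local_ring R p" "F_depth_element R (the_max_ideal R) p x"
    "weakly_F_nilpotent_local (R Quot PIdl\<^bsub>R\<^esub> x) p"
  then show "weakly_F_nilpotent_local R p" by (rule weakly_F_nilpotent_local_of_quotient)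
next
  fix d
  assume "graded_ring R G p" "x \<in> G d" "F_depth_element R (homog_max_ideal R G) p x"
    "weakly_F_nilpotent_graded (R Quot PIdl\<^bsub>R\<^esub> x) (quot_grading R (PIdl\<^bsub>R\<^esub> x) G) p"
  then show "weakly_F_nilpotent_graded R G p" by (rule weakly_F_nilpotent_graded_of_quotient)
qed

end
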